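(* Let $d\ge 1$, let $\mu$ be a strictly elliptic law on $\mathcal P_+$, and let $P_0$ be the annealed law of the associated random walk $(X_n)_{n\ge 0}$ in i.i.d. random environment on $\mathbb Z^d$ started at $0$. Then there are at most two asymptotic directions under $P_0$, i.e. the set $\{\nu\in S^{d-1}: P_0(B_\nu)>0\}$ has at most two elements; and if it has exactly two elements, these are opposite to each other.
   Context: Setting (random walk in i.i.d. random environment). $|\cdot|$ is the Euclidean norm, $S^{d-1}$ the Euclidean unit sphere of $\mathbb R^d$. $\mathcal P_+$ is the set of probability vectors $(p(e))_{e}$ indexed by the $2d$ unit vectors $e\in\mathbb Z^d$, $|e|=1$ (i.e. $p(e)\in[0,1]$, $\sum_e p(e)=1$). An environment is an element $\omega=(\omega_z)_{z\in\mathbb Z^d}$ of $\Omega=\mathcal P_+^{\mathbb Z^d}$. For fixed $\omega$ and $x\in\mathbb Z^d$, $P_{x,\omega}$ (the quenched law) is the law of the Markov chain $(X_n)_{n\ge0}$ on $\mathbb Z^d$ with $P_{x,\omega}(X_0=x)=1$ and $P_{x,\omega}(X_{n+1}=z+e\mid X_n=z)=\omega_z(e)$ for $z,e\in\mathbb Z^d$, $|e|=1$. Given a probability law $\mu$ on $\mathcal P_+$, set $\mathbb P=\mu^{\otimes\mathbb Z^d}$ on $\Omega$; the annealed law $P_x$ on $\Omega\times(\mathbb Z^d)^{\mathbb N}$ is the semi-product $P_x=\mathbb P\times P_{x,\omega}$. Strict ellipticity of $\mu$: for every $e\in\mathbb Z^d$ with $|e|=1$, $\omega_0(e)>0$ $\mathbb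 P$-almost surely. For $\nu\in S^{d-1}$, $B_\nu=\{\lim_{n\to\infty}X_n/|X_n|=\nu\}$ is the event that the walk has asymptotic direction $\nu$. The value given to $X_n/|X_n|$ when $X_n=0$ is an arbitrary fixed convention (e.g. $0$). *)

theory Defs
  imports "HOL-Probability.Probability"
begin

definition real_vec :: "int ^ 'd \<Rightarrow> real ^ 'd"
  where "real_vec z = (\<chi> i. real_of_int (z $ i))"

definition unit_steps :: "(int ^ 'd) set"
  where "unit_steps = {e. norm (real_vec e) = 1}"

definition prob_vectors :: "(int ^ 'd \<Rightarrow> real) set"
  where "prob_vectors =
    {p \<in> unit_steps \<rightarrow>\<^sub>E {0..1}. (\<Sum>e\<in>unit_steps. p e) = 1}"

definition prob_vector_space :: "(int ^ 'd \<Rightarrow> real) measure"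
  where "prob_vector_space = restrict_space (PiM unit_steps (\<lambda>_. borel)) prob_vectors"

definition site_law :: "(int ^ 'd \<Rightarrow> real) measure \<Rightarrow> bool"
  where "site_law \<mu> \<longleftrightarrow> prob_space \<mu> \<and> sets \<mu> = sets prob_vector_space"

type_synonym 'd environment = "int ^ 'd \<Rightarrow> int ^ 'd \<Rightarrow> real"

definition is_environment :: "'d :: finite environment \<Rightarrow> bool"
  where "is_environment \<omega> \<longleftrightarrow> (\<forall>z. \<omega> z \<in> prob_vectors)"

definition env_law :: "(int ^ 'd \<Rightarrow> real) measure \<Rightarrow> 'd environment measure"
  where "env_law \<mu> = PiM UNIV (\<lambda>_. \<mu>)"

definition strictly_elliptic :: "(int ^ 'd \<Rightarrow> real) measure \<Rightarrow> bool"
  where "strictly_elliptic \<mu> \<longleftrightarrow> (\<forall>e\<in>unit_steps. AE \<omega> in env_law \<mu>. 0 < \<omega> 0 e)"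

definition trans_prob :: "'d environment \<Rightarrow> int ^ 'd \<Rightarrow> int ^ 'd \<Rightarrow> real"
  where "trans_prob \<omega> z y = (if y - z \<in> unit_steps then \<omega> z (y - z) else 0)"

definition path_space :: "(nat \<Rightarrow> int ^ 'd) measure"
  where "path_space = PiM UNIV (\<lambda>_. count_space UNIV)"

(* The conditional law of X n given that X i = h i for all i < n. *)
definition step_kernel ::
    "'d environment \<Rightarrow> int ^ 'd \<Rightarrow> nat \<Rightarrow> (nat \<Rightarrow> int ^ 'd) \<Rightarrow> (int ^ 'd) measure"
  where "step_kernel \<omega> x n h =
    (if n = 0 then return (count_space UNIV) x
     else density (count_space UNIV) (\<lambda>y. ennreal (trans_prob \<omega> (h (n - 1)) y)))"

(* The Ionescu-Tulcea measure of the kernels above; emeasure_quenched_law_path below gives its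
   finite-dimensional distributions. *)
definition quenched_law :: "int ^ 'd \<Rightarrow> 'd environment \<Rightarrow> (nat \<Rightarrow> int ^ 'd) measure"
  where "quenched_law x \<omega> =
    projective_family.lim UNIV (Ionescu_Tulcea.CI (step_kernel \<omega> x) (\<lambda>_. count_space UNIV))
      (\<lambda>_. count_space UNIV)"

definition annealed_law ::
    "(int ^ 'd \<Rightarrow> real) measure \<Rightarrow> int ^ 'd \<Rightarrow> ('d environment \<times> (nat \<Rightarrow> int ^ 'd)) measure"
  where "annealed_law \<mu> x =
    env_law \<mu> \<bind>
      (\<lambda>\<omega>. distr (quenched_law x \<omega>) (env_law \<mu> \<Otimes>\<^sub>M path_space) (\<lambda>X. (\<omega>, X)))"

(* By division by zero in HOL, the direction of a walk at the origin is 0. *)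
definition has_asymptotic_direction :: "(nat \<Rightarrow> int ^ 'd) \<Rightarrow> real ^ 'd \<Rightarrow> bool"
  where "has_asymptotic_direction X \<nu> \<longleftrightarrow>
    (\<lambda>n. real_vec (X n) /\<^sub>R norm (real_vec (X n))) \<longlonglongrightarrow> \<nu>"

definition asymptotic_directions :: "(int ^ 'd \<Rightarrow> real) measure \<Rightarrow> int ^ 'd \<Rightarrow> (real ^ 'd) set"
  where "asymptotic_directions \<mu> x =
    {\<nu> \<in> sphere 0 1.
      0 < \<P>(\<omega>X in annealed_law \<mu> x. has_asymptotic_direction (snd \<omega>X) \<nu>)}"


text \<open>
  The constructions above are meaningful: for every environment the quenched law is a probability
  measure with the finite-dimensional distributions of the Markov chain, it is a measurable kernel in
  the environment, the annealed law is the resulting semi-product, and the event of having a given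
  asymptotic direction is measurable.
\<close>

lemma finite_unit_steps: "finite (unit_steps :: (int ^ 'd) set)"
proof -
  have "vec_nth ` (unit_steps :: (int ^ 'd) set) \<subseteq> UNIV \<rightarrow>\<^sub>E {-1..1}"
  proof (intro image_subsetI PiE_I)
    fix e :: "int ^ 'd" and i :: 'd
    assume "e \<in> unit_steps"
    then have "\<bar>real_vec e $ i\<bar> \<le> 1"
      using component_le_norm_cart[of "real_vec e" i] by (simp add: unit_steps_def)
    then have "real_of_int \<bar>e $ i\<bar> \<le> real_of_int 1"
      by (simp add: real_vec_def)
    then have "\<bar>e $ i\<bar> \<le> 1"
      by (simp only: of_int_le_iff)
    then show "e $ i \<in> {-1..1}"
      by auto
  qed simp
  moreover have "finite ((UNIV :: 'd set) \<rightarrow>\<^sub>E {-1..1::int})"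
    by (intro finite_PiE) auto
  ultimately have "finite (vec_nth ` (unit_steps :: (int ^ 'd) set))"
    by (rule finite_subset)
  then show ?thesis
    by (rule finite_imageD) (simp add: inj_on_def vec_nth_inject)
qed

lemma space_prob_vector_space: "space prob_vector_space = prob_vectors"
  by (auto simp: prob_vector_space_def space_restrict_space prob_vectors_def space_PiM)

lemma measurable_prob_vector_apply:
  fixes e :: "int ^ 'd"
  shows
  "(\<lambda>p. p e) \<in> borel_measurable prob_vector_space"
proof (cases "e \<in> unit_steps")
  case True
  then show ?thesis
    unfolding prob_vector_space_def by (intro measurable_restrict_space1) measurable
next
  case False
  then have "p e = undefined" if "p \<in> space prob_vector_space" for p :: "int ^ 'd \<Rightarrow> real"
    using that by (auto simp: space_prob_vector_space prob_vectors_def PiE_def extensional_def)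
  then show ?thesis
    by (subst measurable_cong[where g = "\<lambda>_. undefined"]) auto
qed

lemma prob_space_transition:
  assumes "is_environment \<omega>"
  shows "prob_space (density (count_space UNIV) (\<lambda>y. ennreal (trans_prob \<omega> z y)))"
proof
  let ?t = "\<lambda>y. ennreal (trans_prob \<omega> z y)"
  have p: "\<omega> z \<in> prob_vectors"
    using assms by (simp add: is_environment_def)
  have *: "{y. ?t y \<noteq> 0} \<subseteq> (+) z ` unit_steps"
    by (auto simp: trans_prob_def image_iff split: if_splits) (metis diff_add_cancel add.commute)
  have "emeasure (density (count_space UNIV) ?t) UNIV = (\<integral>\<^sup>+y. ?t y \<partial>count_space UNIV)"
    by (simp add: emeasure_density)
  also have "\<dots> = (\<Sum>y\<in>(+) z ` unit_steps. ?t y)"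
    using * finite_unit_steps by (intro nn_integral_count_space') auto
  also have "\<dots> = (\<Sum>e\<in>unit_steps. ennreal (\<omega> z e))"
    by (subst sum.reindex) (auto simp: trans_prob_def)
  also have "\<dots> = ennreal (\<Sum>e\<in>unit_steps. \<omega> z e)"
    using p by (intro sum_ennreal) (auto simp: prob_vectors_def)
  also have "\<dots> = 1"
    using p by (simp add: prob_vectors_def)
  finally show "emeasure (density (count_space UNIV) ?t) (space (density (count_space UNIV) ?t)) = 1"
    by simp
qed

lemma Ionescu_Tulcea_step_kernel:
  fixes x :: "int ^ 'd"
  assumes "is_environment \<omega>"
  shows "Ionescu_Tulcea (step_kernel \<omega> x) (\<lambda>_. count_space UNIV)"
proof (rule Ionescu_Tulcea.intro)
  fix n :: nat and h :: "nat \<Rightarrow> int ^ 'd"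
  show "prob_space (step_kernel \<omega> x n h)"
    using prob_space_transition[OF assms]
    by (auto simp: step_kernel_def intro!: prob_space_return)
next
  fix n :: nat
  let ?k = "\<lambda>z. density (count_space UNIV) (\<lambda>y. ennreal (trans_prob \<omega> z y))"
  have k: "?k \<in> count_space UNIV \<rightarrow>\<^sub>M subprob_algebra (count_space UNIV)"
    using prob_space_transition[OF assms]
    by (auto simp: space_subprob_algebra prob_space_imp_subprob_space)
  show "step_kernel \<omega> x n \<in> PiM {0..<n} (\<lambda>_. count_space UNIV :: (int ^ 'd) measure) \<rightarrow>\<^sub>M subprob_algebra (count_space UNIV)"
  proof (cases "n = 0")
    case True
    then show ?thesis
      by (auto simp: step_kernel_def[abs_def] space_subprob_algebra prob_space_imp_subprob_space prob_space_return)
  next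
    case False
    then have "(\<lambda>h. h (n - 1)) \<in> PiM {0..<n} (\<lambda>_. count_space UNIV :: (int ^ 'd) measure) \<rightarrow>\<^sub>M count_space UNIV"
      by (intro measurable_component_singleton) auto
    from measurable_compose[OF this k] False show ?thesis
      by (simp add: step_kernel_def[abs_def])
  qed
qed

lemma sets_quenched_law:
  assumes "is_environment \<omega>"
  shows "sets (quenched_law x \<omega>) = sets path_space"
proof -
  interpret Ionescu_Tulcea "step_kernel \<omega> x" "\<lambda>_. count_space UNIV"
    by (rule Ionescu_Tulcea_step_kernel[OF assms])
  show ?thesis by (simp add: quenched_law_def path_space_def)
qed

lemma prob_space_quenched_law:
  assumes "is_environment \<omega>"
  shows "prob_space (quenched_law x \<omega>)"
proof -
  interpret Ionescu_Tulcea "step_kernel \<omega> x" "\<lambda>_. count_space UNIV"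
    by (rule Ionescu_Tulcea_step_kernel[OF assms])
  have "prob_space (distr PF.lim (PiM {} (\<lambda>_. count_space UNIV)) (\<lambda>x. restrict x {}))"
    by (subst distr_lim) (auto intro: PF.prob_space_P)
  then show ?thesis
    unfolding quenched_law_def by (rule prob_space_distrD[rotated]) (auto intro!: measurable_restrict simp: measurable_cong_sets[OF PF.sets_lim refl])
qed

lemma emeasure_quenched_law_path:
  fixes x :: "int ^ 'd"
  assumes "is_environment \<omega>"
  shows "emeasure (quenched_law x \<omega>) {X. \<forall>i\<le>n. X i = y i} =
    (if y 0 = x then \<Prod>i<n. ennreal (trans_prob \<omega> (y i) (y (Suc i))) else 0)"
proof -
  interpret Ionescu_Tulcea "step_kernel \<omega> x" "\<lambda>_. count_space UNIV"
    by (rule Ionescu_Tulcea_step_kernel[OF assms])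
  let ?M = "\<lambda>n. PiM {0..<n} (\<lambda>_. count_space UNIV :: (int ^ 'd) measure)"
  let ?r = "\<lambda>n. restrict y {0..<n}"
  have sp: "?r n \<in> space (?M n)" for n
    by (auto simp: space_PiM)
  have single: "{?r n} \<in> sets (?M n)" for n
  proof -
    have "{?r n} = PiE {0..<n} (\<lambda>i. {y i})"
      by (auto simp: PiE_iff extensional_def fun_eq_iff)
    then show ?thesis by (simp add: sets_PiM_I_finite)
  qed
  have step: "emeasure (C 0 (Suc n) (\<lambda>_. undefined)) {?r (Suc n)} =
      emeasure (C 0 n (\<lambda>_. undefined)) {?r n} * emeasure (step_kernel \<omega> x n (?r n)) {y n}" for n
  proof -
    let ?C = "C 0 n (\<lambda>_. undefined)"
    have C: "sets ?C = sets (?M n)" "space ?C = space (?M n)"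
      using sets_C[of "\<lambda>_. undefined" 0 n] space_C[of "\<lambda>_. undefined" 0 n] by auto
    have "emeasure (C 0 (Suc n) (\<lambda>_. undefined)) {?r (Suc n)} =
        (\<integral>\<^sup>+h. emeasure (eP n h) {?r (Suc n)} \<partial>?C)"
      using single[of "Suc n"] measurable_eP[of n] C sp[of n]
      by (simp, subst emeasure_bind[where N="?M (Suc n)"]) (auto simp: measurable_cong_sets[OF C(1) refl])
    also have "\<dots> = (\<integral>\<^sup>+h. emeasure (step_kernel \<omega> x n (?r n)) {y n} * indicator {?r n} h \<partial>?C)"
    proof (intro nn_integral_cong)
      fix h assume "h \<in> space ?C"
      then have h: "h \<in> space (?M n)" by (simp add: C)
      then have ext: "h \<in> extensional {0..<n}" by (auto simp: space_PiM PiE_def)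
      have "{v. h(n := v) = ?r (Suc n)} = (if h = ?r n then {y n} else {})"
      proof -
        have "h(n := v) = ?r (Suc n) \<longleftrightarrow> h = ?r n \<and> v = y n" for v
        proof
          assume eq: "h(n := v) = ?r (Suc n)"
          have "h i = ?r n i" for i
            using fun_cong[OF eq, of i] ext by (cases "i < n") (auto simp: extensional_def less_Suc_eq split: if_splits)
          moreover have "v = y n" using fun_cong[OF eq, of n] by simp
          ultimately show "h = ?r n \<and> v = y n" by auto
        qed (auto simp: fun_eq_iff)
        then show ?thesis by auto
      qed
      then show "emeasure (eP n h) {?r (Suc n)} =
          emeasure (step_kernel \<omega> x n (?r n)) {y n} * indicator {?r n} h"
        using single[of "Suc n"] h by (auto simp: emeasure_eP vimage_def split: if_splits)
    qed
    also have "\<dots> = emeasure (step_kernel \<omega> x n (?r n)) {y n} * emeasure ?C {?r n}"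
      using single[of n] by (subst nn_integral_cmult_indicator) (auto simp: C)
    finally show ?thesis by (simp add: mult.commute)
  qed
  have C_path: "emeasure (C 0 (Suc n) (\<lambda>_. undefined)) {?r (Suc n)} =
      (if y 0 = x then \<Prod>i<n. ennreal (trans_prob \<omega> (y i) (y (Suc i))) else 0)" for n
  proof (induction n)
    case 0
    have "emeasure (C 0 0 (\<lambda>_. undefined)) {?r 0} = 1"
      using single[of 0] by (simp add: restrict_def)
    moreover have "emeasure (step_kernel \<omega> x 0 (?r 0)) {y 0} = (if y 0 = x then 1 else 0)"
      by (auto simp: step_kernel_def)
    ultimately show ?case
      using step[of 0] by (simp only: mult_1_left lessThan_0 prod.empty)
  next
    case (Suc n)
    have "emeasure (step_kernel \<omega> x (Suc n) (?r (Suc n))) {y (Suc n)} =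
        ennreal (trans_prob \<omega> (y n) (y (Suc n)))"
      by (simp add: step_kernel_def emeasure_density nn_integral_indicator_singleton)
    then show ?case
      unfolding step[of "Suc n"] Suc by simp
  qed
  have "{X. \<forall>i\<le>n. X i = y i} = PF.emb UNIV {0..<Suc n} {?r (Suc n)}"
    by (auto simp: prod_emb_def fun_eq_iff restrict_def less_Suc_eq_le) metis
  then have "emeasure (quenched_law x \<omega>) {X. \<forall>i\<le>n. X i = y i} =
      emeasure (CI {0..<Suc n}) {?r (Suc n)}"
    unfolding quenched_law_def using lim[OF _ single[of "Suc n"]] by simp
  also have "\<dots> = emeasure (C 0 (Suc n) (\<lambda>_. undefined)) {?r (Suc n)}"
    using emeasure_CI[OF order_refl single[of "Suc n"]] single[of "Suc n"]
    by (simp del: C.simps add: prod_emb_id[OF sets.sets_into_space[OF single[of "Suc n"], unfolded space_PiM]])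
  finally show ?thesis by (simp only: C_path)
qed


lemma measurable_trans_prob:
  "(\<lambda>\<omega>. trans_prob \<omega> z y) \<in> borel_measurable (PiM UNIV (\<lambda>_. prob_vector_space))"
  unfolding trans_prob_def
  by (cases "y - z \<in> unit_steps")
    (auto intro: measurable_compose[OF measurable_component_singleton[of z UNIV] measurable_prob_vector_apply])

lemma measurable_quenched_law:
  fixes x :: "int ^ 'd"
  shows "quenched_law x \<in> PiM UNIV (\<lambda>_. prob_vector_space) \<rightarrow>\<^sub>M subprob_algebra path_space"
proof (rule measurable_subprob_algebra_generated[OF _ Int_stable_prod_algebra prod_algebra_sets_into_space])
  let ?E = "PiM UNIV (\<lambda>_. prob_vector_space) :: 'd environment measure"
  let ?M = "\<lambda>_::nat. count_space UNIV :: (int ^ 'd) measure"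
  have env: "is_environment \<omega>" if "\<omega> \<in> space ?E" for \<omega>
    using that by (auto simp: is_environment_def space_PiM space_prob_vector_space)
  show "sets path_space = sigma_sets (\<Pi>\<^sub>E i\<in>UNIV. space (?M i)) (prod_algebra UNIV ?M)"
    by (simp add: path_space_def sets_PiM)
  show "subprob_space (quenched_law x \<omega>)" "sets (quenched_law x \<omega>) = sets path_space"
    if "\<omega> \<in> space ?E" for \<omega>
    using env[OF that] by (auto simp: sets_quenched_law intro!: prob_space_imp_subprob_space prob_space_quenched_law)
  show "(\<lambda>\<omega>. emeasure (quenched_law x \<omega>) (\<Pi>\<^sub>E i\<in>UNIV. space (?M i))) \<in> borel_measurable ?E"
  proof (subst measurable_cong[where g = "\<lambda>_. 1"])
    fix \<omega> assume "\<omega> \<in> space ?E"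
    then interpret prob_space "quenched_law x \<omega>"
      by (intro prob_space_quenched_law env)
    show "emeasure (quenched_law x \<omega>) (\<Pi>\<^sub>E i\<in>UNIV. space (?M i)) = 1"
      using emeasure_space_1 sets_eq_imp_space_eq[OF sets_quenched_law[OF env[OF \<open>\<omega> \<in> space ?E\<close>], of x]]
      by (simp add: path_space_def space_PiM)
  qed simp
  fix A assume "A \<in> prod_algebra UNIV ?M"
  then obtain J F where A: "A = prod_emb UNIV ?M J (\<Pi>\<^sub>E j\<in>J. F j)" and J: "finite J"
    by (rule prod_algebraE) auto
  define n where "n = \<Sum>J"
  have n: "j \<le> n" if "j \<in> J" for j
    using J that by (auto simp: n_def intro: member_le_sum)
  define I where "I = {h \<in> {..n} \<rightarrow>\<^sub>E (UNIV :: (int ^ 'd) set). \<forall>j\<in>J. h j \<in> F j}"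
  have I: "countable I"
    by (rule countable_subset[of _ "{..n} \<rightarrow>\<^sub>E UNIV"]) (auto simp: I_def intro: countable_PiE)
  let ?c = "\<lambda>h. {X. \<forall>i\<le>n. X i = h i}"
  have "A = {X. \<forall>j\<in>J. X j \<in> F j}"
    by (auto simp: A prod_emb_def PiE_iff)
  also have "\<dots> = (\<Union>h\<in>I. ?c h)"
  proof (intro equalityI subsetI)
    fix X assume "X \<in> {X. \<forall>j\<in>J. X j \<in> F j}"
    then show "X \<in> (\<Union>h\<in>I. ?c h)"
      using n by (intro UN_I[of "restrict X {..n}"]) (auto simp: I_def)
  qed (use n in \<open>auto simp: I_def\<close>)
  finally have A_eq: "A = (\<Union>h\<in>I. ?c h)" .
  have c: "?c h \<in> sets path_space" for h :: "nat \<Rightarrow> int ^ 'd"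
  proof -
    have "?c h = prod_emb UNIV ?M {..n} (\<Pi>\<^sub>E i\<in>{..n}. {h i})"
      by (auto simp: prod_emb_def PiE_iff)
    then show ?thesis
      unfolding path_space_def by (auto intro!: sets_PiM_I)
  qed
  have disj: "disjoint_family_on ?c I"
    by (auto simp: disjoint_family_on_def I_def PiE_def extensional_def fun_eq_iff) (metis atMost_iff)
  let ?p = "\<lambda>\<omega> h. if h 0 = x then \<Prod>i<n. ennreal (trans_prob \<omega> (h i) (h (Suc i))) else 0"
  have p: "(\<lambda>\<omega>. ?p \<omega> h) \<in> borel_measurable ?E" for h :: "nat \<Rightarrow> int ^ 'd"
    using measurable_trans_prob
    by (cases "h 0 = x") (auto intro!: borel_measurable_prod_ennreal measurable_compose[OF _ measurable_ennreal])
  have "emeasure (quenched_law x \<omega>) A = (\<integral>\<^sup>+h. ?p \<omega> h \<partial>count_space I)" if "\<omega> \<in> space ?E" for \<omega>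
    unfolding A_eq using that c I disj
    by (subst emeasure_UN_countable) (auto simp: sets_quenched_law env emeasure_quenched_law_path)
  moreover have "(\<lambda>\<omega>. \<integral>\<^sup>+h. ?p \<omega> h \<partial>count_space I) \<in> borel_measurable ?E"
  proof -
    interpret sigma_finite_measure "count_space I"
      by (rule sigma_finite_measure_count_space_countable[OF I])
    have "(\<lambda>z. ?p (fst z) (snd z)) \<in> borel_measurable (?E \<Otimes>\<^sub>M count_space I)"
      by (rule measurable_compose_countable'[where I = I and g = snd and f = "\<lambda>h z. ?p (fst z) h"])
        (auto intro: I measurable_compose[OF measurable_fst p])
    then show ?thesis
      by (intro borel_measurable_nn_integral) (simp add: case_prod_beta')
  qed
  ultimately show "(\<lambda>\<omega>. emeasure (quenched_law x \<omega>) A) \<in> borel_measurable ?E"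
    by (subst measurable_cong) auto
qed

context
  fixes \<mu> :: "(int ^ 'd \<Rightarrow> real) measure"
  assumes \<mu>: "site_law \<mu>"
begin

lemma sets_env_law: "sets (env_law \<mu>) = sets (PiM UNIV (\<lambda>_. prob_vector_space))"
  using \<mu> unfolding env_law_def site_law_def by (intro sets_PiM_cong) auto

lemma prob_space_env_law: "prob_space (env_law \<mu>)"
  using \<mu> unfolding env_law_def site_law_def by (intro prob_space_PiM) auto

lemma is_environment_env_law:
  "\<omega> \<in> space (env_law \<mu>) \<Longrightarrow> is_environment \<omega>"
  using sets_eq_imp_space_eq[OF sets_env_law]
  by (auto simp: is_environment_def space_PiM space_prob_vector_space)

lemma measurable_annealed_kernel:
  "(\<lambda>\<omega>. distr (quenched_law x \<omega>) (env_law \<mu> \<Otimes>\<^sub>M path_space) (\<lambda>X. (\<omega>, X)))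
    \<in> env_law \<mu> \<rightarrow>\<^sub>M subprob_algebra (env_law \<mu> \<Otimes>\<^sub>M path_space)"
  using measurable_quenched_law[of x]
  by (intro measurable_distr2[where M = path_space]) (auto simp: measurable_cong_sets[OF sets_env_law refl])

lemma prob_space_annealed_law: "prob_space (annealed_law \<mu> x)"
  unfolding annealed_law_def
  by (intro prob_space.prob_space_bind[OF prob_space_env_law _ measurable_annealed_kernel] AE_I2
      prob_space.prob_space_distr prob_space_quenched_law is_environment_env_law)
    (auto simp: measurable_cong_sets[OF sets_quenched_law[OF is_environment_env_law] refl])

lemma sets_annealed_law: "sets (annealed_law \<mu> x) = sets (env_law \<mu> \<Otimes>\<^sub>M path_space)"
  unfolding annealed_law_def
  using prob_space.not_empty[OF prob_space_env_law] by (subst sets_bind) auto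

lemma emeasure_annealed_law:
  assumes "A \<in> sets (env_law \<mu> \<Otimes>\<^sub>M path_space)"
  shows "emeasure (annealed_law \<mu> x) A =
    (\<integral>\<^sup>+\<omega>. emeasure (quenched_law x \<omega>) {X. (\<omega>, X) \<in> A} \<partial>env_law \<mu>)"
proof -
  have "space (quenched_law x \<omega>) = UNIV" if "\<omega> \<in> space (env_law \<mu>)" for \<omega>
    using sets_eq_imp_space_eq[OF sets_quenched_law[OF is_environment_env_law[OF that]]]
    by (simp add: path_space_def space_PiM)
  then show ?thesis
    unfolding annealed_law_def
    using assms prob_space.not_empty[OF prob_space_env_law] measurable_annealed_kernel
    by (subst emeasure_bind[where N = "env_law \<mu> \<Otimes>\<^sub>M path_space"])
      (auto intro!: nn_integral_cong simp: vimage_def emeasure_distr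
        measurable_cong_sets[OF sets_quenched_law[OF is_environment_env_law] refl])
qed

lemma sets_has_asymptotic_direction:
  "{\<omega>X \<in> space (annealed_law \<mu> x). has_asymptotic_direction (snd \<omega>X) \<nu>} \<in> sets (annealed_law \<mu> x)"
proof -
  have "(\<lambda>\<omega>X. (real_vec (snd \<omega>X n) /\<^sub>R norm (real_vec (snd \<omega>X n)))) \<in> borel_measurable (annealed_law \<mu> x)" for n
  proof -
    have "(\<lambda>\<omega>X. snd \<omega>X n) \<in> env_law \<mu> \<Otimes>\<^sub>M path_space \<rightarrow>\<^sub>M count_space UNIV"
      unfolding path_space_def by measurable
    from measurable_compose[OF this, of "\<lambda>z. real_vec z /\<^sub>R norm (real_vec z)" borel] show ?thesis
      by (simp add: measurable_cong_sets[OF sets_annealed_law refl])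
  qed
  then have "Measurable.pred (annealed_law \<mu> x) (\<lambda>\<omega>X.
      (\<lambda>n. dist (real_vec (snd \<omega>X n) /\<^sub>R norm (real_vec (snd \<omega>X n))) \<nu>) \<longlonglongrightarrow> 0)"
    by (intro measurable_limit2 borel_measurable_dist) auto
  then show ?thesis
    unfolding has_asymptotic_direction_def tendsto_dist_iff[of _ \<nu>] by (simp add: pred_def)
qed

end

end

theory Submission
  imports Defs
begin

text \<open>
  By ellipticity a walk that visits some site infinitely often visits \<^term>\<open>0\<close> infinitely often, so a
  walk with an asymptotic direction \<open>\<nu>\<close> is almost surely transient, and then \<open>l \<bullet> X n \<rightarrow> \<infinity>\<close> whenever
  \<open>l \<bullet> \<nu> > 0\<close>. Suppose that \<open>\<nu> \<noteq> \<nu>'\<close> are asymptotic directions which are not opposite, and let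
  \<open>l = \<nu> + \<nu>'\<close>, so that \<open>l \<bullet> \<nu> > 0\<close> and \<open>l \<bullet> \<nu>' > 0\<close>. Restarting the walk at a time that minimises
  \<open>l \<bullet> X n\<close> shows that with positive probability it has direction \<open>\<nu>'\<close> and never goes below its
  starting level. At a strict record time of \<open>l \<bullet> X n\<close> the future of such a walk only sees fresh
  sites, so at every record it gets a new chance, of a probability bounded below, to take direction
  \<open>\<nu>'\<close>. A walk with direction \<open>\<nu>\<close> has infinitely many records, which makes direction \<open>\<nu>\<close> a null event.
\<close>

subsection \<open>Events on path space\<close>

lemma space_path_space [simp]: "space path_space = UNIV"
  by (simp add: path_space_def space_PiM)

lemma UNIV_in_sets_path_space [simp]: "UNIV \<in> sets path_space"
  using sets.top[of path_space] by simp

lemma space_eq_UNIV: "sets M = sets path_space \<Longrightarrow> space M = UNIV"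
  by (drule sets_eq_imp_space_eq) simp

section \<open>Cylinders and events decided by a finite time\<close>

definition cylinder :: "nat \<Rightarrow> (nat \<Rightarrow> 'a) \<Rightarrow> (nat \<Rightarrow> 'a) set"
  where "cylinder n y = {X. \<forall>i\<le>n. X i = y i}"

text \<open>One implication for all pairs suffices, since the roles of \<open>X\<close> and
  \<open>Y\<close> can be exchanged.\<close>

definition adapted :: "nat \<Rightarrow> (nat \<Rightarrow> 'a) set \<Rightarrow> bool"
  where "adapted n A \<longleftrightarrow> (\<forall>X Y. (\<forall>i\<le>n. X i = Y i) \<longrightarrow> X \<in> A \<longrightarrow> Y \<in> A)"

lemma adaptedD: "adapted n A \<Longrightarrow> (\<And>i. i \<le> n \<Longrightarrow> X i = Y i) \<Longrightarrow> X \<in> A \<longleftrightarrow> Y \<in> A"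
  unfolding adapted_def by metis

lemma adapted_mono:
  assumes "adapted n A" "n \<le> m"
  shows "adapted m A"
  unfolding adapted_def
proof (intro allI impI)
  fix X Y assume eq: "\<forall>i\<le>m. X i = Y i" and "X \<in> A"
  have "X i = Y i" if "i \<le> n" for i
    using eq that \<open>n \<le> m\<close> by simp
  then have "X \<in> A \<longleftrightarrow> Y \<in> A"
    by (rule adaptedD[OF \<open>adapted n A\<close>])
  then show "Y \<in> A"
    using \<open>X \<in> A\<close> by simp
qed

lemma adapted_Int: "adapted n A \<Longrightarrow> adapted n B \<Longrightarrow> adapted n (A \<inter> B)"
  unfolding adapted_def by blast

lemma adapted_Compl: "adapted n A \<Longrightarrow> adapted n (- A)"
  unfolding adapted_def by (metis Compl_iff)

lemma adapted_UN: "(\<And>i. i \<in> I \<Longrightarrow> adapted n (A i)) \<Longrightarrow> adapted n (\<Union>i\<in>I. A i)"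
  unfolding adapted_def by blast

lemma adapted_cylinder: "adapted n (cylinder n y)"
  unfolding adapted_def cylinder_def by simp

lemma sets_cylinder [measurable]: "cylinder n y \<in> sets path_space"
proof -
  have "cylinder n y = prod_emb UNIV (\<lambda>_. count_space UNIV) {..n} (\<Pi>\<^sub>E i\<in>{..n}. {y i})"
    by (auto simp: cylinder_def prod_emb_def PiE_iff)
  then show ?thesis
    unfolding path_space_def by (auto intro!: sets_PiM_I)
qed

text \<open>Each cylinder up to time \<open>n\<close> gets a unique representative, the path that is
  \<open>undefined\<close> after \<open>n\<close>. Over a countable state space this leaves
  countably many disjoint cylinders.\<close>

abbreviation initial_segments :: "nat \<Rightarrow> (nat \<Rightarrow> 'a) set"
  where "initial_segments n \<equiv> {..n} \<rightarrow>\<^sub>E UNIV"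

lemma countable_initial_segments: "countable (initial_segments n :: (nat \<Rightarrow> int ^ 'd) set)"
  by (auto intro: countable_PiE)

lemma adapted_eq_UN:
  assumes "adapted n A"
  shows "A = (\<Union>h\<in>A \<inter> initial_segments n. cylinder n h)"
proof (intro equalityI subsetI)
  fix X assume X: "X \<in> A"
  then have "restrict X {..n} \<in> A"
    using adaptedD[OF assms, of X "restrict X {..n}"] by simp
  then show "X \<in> (\<Union>h\<in>A \<inter> initial_segments n. cylinder n h)"
    by (intro UN_I[of "restrict X {..n}"]) (auto simp: cylinder_def)
next
  fix X assume "X \<in> (\<Union>h\<in>A \<inter> initial_segments n. cylinder n h)"
  then obtain h where "h \<in> A" "X \<in> cylinder n h" by auto
  then show "X \<in> A"
    using adaptedD[OF assms, of X h] by (simp add: cylinder_def)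
qed

lemma disjoint_cylinders: "disjoint_family_on (cylinder n) (initial_segments n)"
  by (auto simp: disjoint_family_on_def cylinder_def PiE_def extensional_def fun_eq_iff)
     (metis atMost_iff)

lemma sets_adapted:
  fixes A :: "(nat \<Rightarrow> int ^ 'd) set"
  assumes "adapted n A"
  shows "A \<in> sets path_space"
  by (subst adapted_eq_UN[OF assms], rule sets.countable_UN')
     (auto intro: countable_subset[OF _ countable_initial_segments[of n]])

text \<open>Countable additivity over the cylinders that make up \<open>A\<close>. The sum is
  written as an integral over a counting measure, so monotonicity and scaling come from integration
  theory.\<close>

lemma emeasure_adapted_Int:
  fixes A :: "(nat \<Rightarrow> int ^ 'd) set"
  assumes M: "sets M = sets path_space" and A: "adapted n A" and B: "B \<in> sets path_space"
  shows "emeasure M (A \<inter> B) =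
    (\<integral>\<^sup>+h. emeasure M (cylinder n h \<inter> B) \<partial>count_space (A \<inter> initial_segments n))"
proof -
  have "A \<inter> B = (\<Union>h\<in>A \<inter> initial_segments n. cylinder n h \<inter> B)"
    using adapted_eq_UN[OF A] by blast
  also have "emeasure M \<dots> = (\<integral>\<^sup>+h. emeasure M (cylinder n h \<inter> B) \<partial>count_space (A \<inter> initial_segments n))"
  proof (rule emeasure_UN_countable)
    show "countable (A \<inter> initial_segments n)"
      by (rule countable_subset[OF _ countable_initial_segments[of n]]) auto
    show "disjoint_family_on (\<lambda>h. cylinder n h \<inter> B) (A \<inter> initial_segments n)"
      using disjoint_cylinders[of n] by (fastforce simp: disjoint_family_on_def)
  qed (use B M in auto)
  finally show ?thesis .
qed

lemma emeasure_adapted: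
  fixes A :: "(nat \<Rightarrow> int ^ 'd) set"
  assumes "sets M = sets path_space" "adapted n A"
  shows "emeasure M A =
    (\<integral>\<^sup>+h. emeasure M (cylinder n h) \<partial>count_space (A \<inter> initial_segments n))"
  using emeasure_adapted_Int[OF assms, of UNIV] sets.top[of path_space] by simp

section \<open>Adapted events as a generator of the path space\<close>

lemma sets_path_space_eq:
  "sets (path_space :: (nat \<Rightarrow> int ^ 'd) measure) = sigma_sets UNIV {A. \<exists>n. adapted n A}"
proof (intro equalityI)
  let ?M = "\<lambda>_::nat. count_space UNIV :: (int ^ 'd) measure"
  have "\<exists>n. adapted n A" if "A \<in> prod_algebra UNIV ?M" for A
  proof -
    from that obtain J F where A: "A = prod_emb UNIV ?M J (\<Pi>\<^sub>E j\<in>J. F j)" and J: "finite J"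
      by (rule prod_algebraE) auto
    \<comment> \<open>The sum of the finitely many constrained times is a convenient upper bound for
      all of them.\<close>
    have "j \<le> \<Sum>J" if "j \<in> J" for j
      using J that by (auto intro: member_le_sum)
    then have "adapted (\<Sum>J) A"
      by (auto simp: adapted_def A prod_emb_def PiE_iff)
    then show ?thesis ..
  qed
  then show "sets path_space \<subseteq> sigma_sets UNIV {A :: (nat \<Rightarrow> int ^ 'd) set. \<exists>n. adapted n A}"
    unfolding path_space_def sets_PiM by (auto intro!: sigma_sets_mono)
  show "sigma_sets UNIV {A :: (nat \<Rightarrow> int ^ 'd) set. \<exists>n. adapted n A} \<subseteq> sets path_space"
    using sets.sigma_sets_subset[of "{A. \<exists>n. adapted n A}" path_space] sets_adapted by auto
qed

text \<open>Values on cylinders determine those on adapted events, which form an intersection-stable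
  generator containing the whole space.\<close>

lemma path_measure_eqI:
  assumes M: "sets M = sets path_space" and N: "sets N = sets path_space"
    and fin: "emeasure M UNIV \<noteq> \<infinity>"
    and eq: "\<And>n y. emeasure M (cylinder n y) = emeasure N (cylinder n (y :: nat \<Rightarrow> int ^ 'd))"
  shows "M = N"
proof (rule measure_eqI_generator_eq)
  let ?E = "{A :: (nat \<Rightarrow> int ^ 'd) set. \<exists>n. adapted n A}"
  show "Int_stable ?E"
  proof (rule Int_stableI)
    fix A B :: "(nat \<Rightarrow> int ^ 'd) set"
    assume "A \<in> ?E" "B \<in> ?E"
    then obtain m n where "adapted m A" "adapted n B"
      by auto
    then have "adapted (max m n) (A \<inter> B)"
      by (intro adapted_Int) (auto elim: adapted_mono)
    then show "A \<inter> B \<in> ?E"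
      by auto
  qed
  show "emeasure M A = emeasure N A" if "A \<in> ?E" for A
    using that emeasure_adapted[OF M] emeasure_adapted[OF N] by (auto simp: eq)
  show "range (\<lambda>_::nat. UNIV) \<subseteq> ?E"
    by (auto simp: adapted_def)
qed (use M N fin in \<open>auto simp: sets_path_space_eq\<close>)

text \<open>The events that can be approximated in measure contain the adapted ones and are closed
  under complements and countable unions.\<close>

lemma adapted_approximation:
  fixes M :: "(nat \<Rightarrow> int ^ 'd) measure" and A :: "(nat \<Rightarrow> int ^ 'd) set"
  assumes "finite_measure M" and M: "sets M = sets path_space"
    and A: "A \<in> sets path_space" and "0 < \<epsilon>"
  shows "\<exists>n F. adapted n F \<and> measure M (sym_diff A F) < \<epsilon>"
  using A[unfolded sets_path_space_eq] \<open>0 < \<epsilon>\<close>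
proof (induction arbitrary: \<epsilon> rule: sigma_sets.induct)
  case (Basic A)
  then obtain n where "adapted n A"
    by blast
  then show ?case
    using Basic.prems by (intro exI[of _ n] exI[of _ A]) simp
next
  case Empty
  then show ?case
    by (intro exI[of _ 0] exI[of _ "{}"]) (auto simp: adapted_def)
next
  case (Compl A)
  then obtain n F where "adapted n F" "measure M (sym_diff A F) < \<epsilon>"
    by blast
  moreover have "sym_diff (UNIV - A) (- F) = sym_diff A F"
    by auto
  ultimately show ?case
    by (metis adapted_Compl)
next
  case (Union A)
  interpret finite_measure M by fact
  have [measurable]: "A i \<in> sets M" for i
    using Union.hyps by (simp add: M sets_path_space_eq)
  \<comment> \<open>Half of the error pays for cutting the union down to finitely many sets, the
    other half for approximating each of these.\<close>
  have "(\<lambda>k. measure M (\<Union>i<k. A i)) \<longlonglongrightarrow> measure M (\<Union>k. \<Union>i<k. A i)"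
    by (rule finite_Lim_measure_incseq) (fastforce simp: incseq_def intro: less_le_trans)+
  moreover have "(\<Union>k. \<Union>i<k. A i) = (\<Union>i. A i)"
    by auto
  ultimately have "\<forall>\<^sub>F k in sequentially. measure M (\<Union>i. A i) - \<epsilon> / 2 < measure M (\<Union>i<k. A i)"
    using Union.prems by (intro order_tendstoD(1)) auto
  then obtain k where k: "measure M (\<Union>i. A i) - \<epsilon> / 2 < measure M (\<Union>i<k. A i)"
    by (auto simp: eventually_sequentially)
  \<comment> \<open>\<open>Suc k\<close> instead of \<open>k\<close> keeps the denominator positive
    for an empty partial union.\<close>
  have "\<exists>n F. adapted n F \<and> measure M (sym_diff (A i) F) < \<epsilon> / (2 * Suc k)" for i
    using Union.prems by (intro Union.IH) simp
  then obtain n F where F: "\<And>i. adapted (n i) (F i)"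
    "\<And>i. measure M (sym_diff (A i) (F i)) < \<epsilon> / (2 * Suc k)"
    by metis
  have [measurable]: "F i \<in> sets M" for i
    using sets_adapted[OF F(1)] by (simp add: M)
  have "adapted (\<Sum>i<k. n i) (\<Union>i<k. F i)"
    by (intro adapted_UN adapted_mono[OF F(1)] member_le_sum) auto
  moreover have "measure M (sym_diff (\<Union>i. A i) (\<Union>i<k. F i)) < \<epsilon>"
  proof -
    have "measure M (sym_diff (\<Union>i. A i) (\<Union>i<k. F i))
        \<le> measure M (((\<Union>i. A i) - (\<Union>i<k. A i)) \<union> (\<Union>i<k. sym_diff (A i) (F i)))"
      by (rule finite_measure_mono) auto
    also have "\<dots> \<le> measure M ((\<Union>i. A i) - (\<Union>i<k. A i)) + measure M (\<Union>i<k. sym_diff (A i) (F i))"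
      by (rule measure_Un_le) auto
    also have "measure M (\<Union>i<k. sym_diff (A i) (F i)) \<le> (\<Sum>i<k. measure M (sym_diff (A i) (F i)))"
      by (rule measure_UNION_le) auto
    also have "\<dots> \<le> (\<Sum>i<k. \<epsilon> / (2 * Suc k))"
      using F(2) by (intro sum_mono less_imp_le)
    also have "\<dots> \<le> \<epsilon> / 2"
      using Union.prems by (simp add: field_simps)
    also have "measure M ((\<Union>i. A i) - (\<Union>i<k. A i)) = measure M (\<Union>i. A i) - measure M (\<Union>i<k. A i)"
      by (rule finite_measure_Diff) auto
    finally show ?thesis
      using k by linarith
  qed
  ultimately show ?case by blast
qed

text \<open>
  A substitute for Levy's zero-one law: if \<^term>\<open>G\<close> is approximated by an event \<open>F\<close> adapted to time \<open>k\<close>, then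
  from \<open>F\<close> the first \<^term>\<open>R\<close>-time after \<open>k\<close> leads out of \<^term>\<open>G\<close> with a conditional probability of at
  least \<^term>\<open>c\<close>, whereas it almost never does.
\<close>

lemma null_if_repeated_chances:
  fixes M :: "(nat \<Rightarrow> int ^ 'd) measure" and G :: "(nat \<Rightarrow> int ^ 'd) set" and H :: "nat \<Rightarrow> (nat \<Rightarrow> int ^ 'd) set"
  assumes "finite_measure M" and M: "sets M = sets path_space" and "0 < c"
    and R: "\<And>n. adapted n (R n)" and H: "\<And>n. H n \<in> sets path_space"
    and chance: "\<And>n y. y \<in> R n \<Longrightarrow>
      ennreal c * emeasure M (cylinder n y) \<le> emeasure M (cylinder n y \<inter> H n)"
    and G: "G \<in> sets path_space"
    and repeated: "\<And>X n. X \<in> G \<Longrightarrow> \<exists>m\<ge>n. X \<in> R m"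
    and avoid: "\<And>n. N \<le> n \<Longrightarrow> G \<inter> R n \<inter> H n = {}"
  shows "emeasure M G = 0"
proof -
  interpret finite_measure M by fact
  have bound: "c * measure M (F \<inter> G) \<le> measure M (F - G)" if F: "adapted k F" for k F
  proof -
    \<comment> \<open>From time \<open>m\<close> on, \<open>F\<close> is already decided and
      \<open>avoid\<close> applies.\<close>
    define m where "m = max k N"
    \<comment> \<open>\<open>T n\<close> says that \<open>n\<close> is the first
      \<open>R\<close>-time from \<open>m\<close> on. These events are disjoint, and on
      \<open>G\<close> one of them occurs.\<close>
    define T where "T n = (if n < m then {} else R n - (\<Union>j\<in>{m..<n}. R j))" for n
    have T: "adapted n (T n)" for n
    proof (cases "n < m")
      case False
      have "adapted n (R n \<inter> - (\<Union>j\<in>{m..<n}. R j))"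
        by (intro adapted_Int R adapted_Compl adapted_UN adapted_mono[OF R]) auto
      then show ?thesis using False by (simp add: T_def Diff_eq)
    qed (simp add: T_def adapted_def)
    have disj: "disjoint_family T"
      proof -
      have "T i \<inter> T j = {}" if "i < j" for i j
        using that by (auto simp: T_def)
      then show ?thesis
        unfolding disjoint_family_on_def by (metis Int_commute linorder_neqE_nat)
    qed
    have FT: "adapted n (F \<inter> T n)" for n
    proof (cases "n < m")
      case False
      then show ?thesis by (intro adapted_Int T adapted_mono[OF F]) (simp add: m_def)
    qed (simp add: T_def adapted_def)
    note [measurable] = sets_adapted[OF FT, folded M] sets_adapted[OF F, folded M] H[folded M] G[folded M]
    have "F \<inter> G \<subseteq> (\<Union>n. F \<inter> T n)"
    proof
      fix X assume X: "X \<in> F \<inter> G"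
      define n where "n = (LEAST n. m \<le> n \<and> X \<in> R n)"
      have ex: "\<exists>n. m \<le> n \<and> X \<in> R n" using repeated[of X m] X by auto
      have "m \<le> n \<and> X \<in> R n" unfolding n_def by (rule LeastI_ex[OF ex])
      moreover have "X \<notin> R j" if "j \<in> {m..<n}" for j
        using not_less_Least[of j "\<lambda>n. m \<le> n \<and> X \<in> R n"] that by (auto simp: n_def)
      ultimately have "X \<in> F \<inter> T n" using X by (auto simp: T_def)
      then show "X \<in> (\<Union>n. F \<inter> T n)" by blast
    qed
    moreover have "(\<Union>n. F \<inter> T n) \<in> sets M"
      by measurable
    ultimately have "ennreal c * emeasure M (F \<inter> G) \<le> ennreal c * emeasure M (\<Union>n. F \<inter> T n)"
      by (intro mult_left_mono emeasure_mono) (auto simp del: UN_simps)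
    also have "emeasure M (\<Union>n. F \<inter> T n) = (\<Sum>n. emeasure M (F \<inter> T n))"
      using disj by (intro suminf_emeasure[symmetric]) (auto simp: disjoint_family_on_def)
    also have "ennreal c * \<dots> = (\<Sum>n. ennreal c * emeasure M (F \<inter> T n))"
      by simp
    also have "\<dots> \<le> (\<Sum>n. emeasure M (F \<inter> T n \<inter> H n))"
    proof (intro suminf_le)
      fix n
      have "ennreal c * emeasure M (F \<inter> T n) =
          (\<integral>\<^sup>+h. ennreal c * emeasure M (cylinder n h) \<partial>count_space (F \<inter> T n \<inter> initial_segments n))"
        by (subst emeasure_adapted[OF M FT], rule nn_integral_cmult[symmetric]) simp
      \<comment> \<open>Every cylinder of the sum has its representative in \<open>T n\<close>,
        hence in \<open>R n\<close>, where \<open>chance\<close> applies.\<close>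
      also have "\<dots> \<le> (\<integral>\<^sup>+h. emeasure M (cylinder n h \<inter> H n) \<partial>count_space (F \<inter> T n \<inter> initial_segments n))"
        by (intro nn_integral_mono chance) (auto simp: T_def split: if_splits)
      also have "\<dots> = emeasure M (F \<inter> T n \<inter> H n)"
        by (rule emeasure_adapted_Int[OF M FT H, symmetric])
      finally show "ennreal c * emeasure M (F \<inter> T n) \<le> emeasure M (F \<inter> T n \<inter> H n)" .
    qed auto
    also have "\<dots> = emeasure M (\<Union>n. F \<inter> T n \<inter> H n)"
      using disj by (intro suminf_emeasure) (auto simp: disjoint_family_on_def)
    also have "\<dots> \<le> emeasure M (F - G)"
    proof (intro emeasure_mono)
      have "F \<inter> T n \<inter> H n \<subseteq> F - G" for n
        using avoid[of n] by (cases "n < m") (auto simp: T_def m_def less_max_iff_disj)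
      then show "(\<Union>n. F \<inter> T n \<inter> H n) \<subseteq> F - G" by blast
    qed measurable
    finally show ?thesis
      using \<open>0 < c\<close> by (simp add: emeasure_eq_measure flip: ennreal_mult)
  qed
  have "c * measure M G \<le> 0 + \<epsilon>" if "0 < \<epsilon>" for \<epsilon>
  proof -
    \<comment> \<open>If \<delta> is the measure of the symmetric difference, the bound above gives
      \<open>c * measure M G\<close> at most (1 + c) \<delta>; hence the divisor
      \<open>1 + c\<close>.\<close>
    obtain k F where F: "adapted k F" and *: "measure M (sym_diff G F) < \<epsilon> / (1 + c)"
      using adapted_approximation[OF \<open>finite_measure M\<close> M G, of "\<epsilon> / (1 + c)"] \<open>0 < c\<close> \<open>0 < \<epsilon>\<close> by auto
    note [measurable] = sets_adapted[OF F, folded M] G[folded M]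
    have 1: "measure M (F - G) \<le> measure M (sym_diff G F)" "measure M (G - F) \<le> measure M (sym_diff G F)"
      by (auto intro!: finite_measure_mono)
    have "measure M G = measure M (F \<inter> G) + measure M (G - F)"
      by (subst finite_measure_Union[symmetric]) (auto intro!: arg_cong[where f="measure M"])
    then have "c * measure M G = c * measure M (F \<inter> G) + c * measure M (G - F)"
      by (simp add: algebra_simps)
    also have "\<dots> \<le> measure M (sym_diff G F) + c * measure M (sym_diff G F)"
      using bound[OF F] 1 \<open>0 < c\<close> by (intro add_mono mult_left_mono) auto
    also have "\<dots> = (1 + c) * measure M (sym_diff G F)" by (simp add: algebra_simps)
    also have "\<dots> \<le> \<epsilon>" using * \<open>0 < c\<close> by (simp add: field_simps)
    finally show ?thesis by simp
  qed
  then have "c * measure M G \<le> 0" by (rule field_le_epsilon)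
  then have "measure M G = 0"
    using \<open>0 < c\<close> measure_nonneg[of M G] by (simp add: mult_le_0_iff)
  then show ?thesis by (simp add: emeasure_eq_measure)
qed

subsection \<open>Markov property and independence of the environment\<close>

definition time_shift :: "nat \<Rightarrow> (nat \<Rightarrow> 'a) \<Rightarrow> nat \<Rightarrow> 'a"
  where "time_shift n X = (\<lambda>i. X (n + i))"

lemma time_shift_apply: "time_shift n X i = X (n + i)"
  by (simp add: time_shift_def)

definition confined :: "'a set \<Rightarrow> (nat \<Rightarrow> 'a) set"
  where "confined S = {X. \<forall>i. X i \<in> S}"

lemma measurable_coordinate [measurable]: "(\<lambda>X. X n) \<in> path_space \<rightarrow>\<^sub>M count_space UNIV"
  unfolding path_space_def by measurable

lemma pred_coordinate_eq [measurable]: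
  "Measurable.pred path_space (\<lambda>X. X n = (z :: int ^ 'd))"
  by (rule measurable_compose[OF measurable_coordinate]) simp

lemma measurable_path_spaceI:
  "(\<And>n. (\<lambda>\<omega>. f \<omega> n) \<in> M \<rightarrow>\<^sub>M count_space UNIV) \<Longrightarrow> f \<in> M \<rightarrow>\<^sub>M path_space"
  unfolding path_space_def by (rule measurable_PiM_single') auto

lemma measurable_time_shift [measurable]: "time_shift n \<in> path_space \<rightarrow>\<^sub>M path_space"
  unfolding time_shift_def by (rule measurable_path_spaceI) measurable

lemma sets_Collect_path_space: "Measurable.pred path_space P \<Longrightarrow> Collect P \<in> sets path_space"
  by (simp add: pred_def)

lemma sets_confined [measurable]: "confined (S :: (int ^ 'd) set) \<in> sets path_space"
  unfolding confined_def by (rule sets_Collect_path_space) measurable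

lemma sets_vimage_path_space:
  assumes "f \<in> path_space \<rightarrow>\<^sub>M path_space" "A \<in> sets path_space"
  shows "f -` A \<in> sets path_space"
  using measurable_sets[OF assms] by simp

lemma emeasure_quenched_law_cylinder:
  assumes "is_environment \<omega>"
  shows "emeasure (quenched_law x \<omega>) (cylinder n y) =
    (if y 0 = x then \<Prod>i<n. ennreal (trans_prob \<omega> (y i) (y (Suc i))) else 0)"
  unfolding cylinder_def by (rule emeasure_quenched_law_path[OF assms])

lemma emeasure_quenched_law_UNIV:
  assumes "is_environment \<omega>"
  shows "emeasure (quenched_law x \<omega>) UNIV = 1"
  using prob_space.emeasure_space_1[OF prob_space_quenched_law[OF assms]]
    space_eq_UNIV[OF sets_quenched_law[OF assms]] by metis

lemma prod_lessThan_add: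
  "(\<Prod>i<n + k. f i) = (\<Prod>i<n. f i) * (\<Prod>i<k. f (n + i))" for f :: "nat \<Rightarrow> 'a :: comm_monoid_mult"
  by (induction k) (auto simp: mult.assoc)

text \<open>In \<open>A\<close> both sides are finite measures, so cylinders suffice, and there the
  product of transition probabilities splits at time \<open>n\<close>. The product form avoids
  conditioning on null cylinders.\<close>

lemma quenched_markov:
  fixes y :: "nat \<Rightarrow> int ^ 'd"
  assumes \<omega>: "is_environment \<omega>" and A: "A \<in> sets path_space"
  shows "emeasure (quenched_law x \<omega>) (cylinder n y \<inter> time_shift n -` A) =
    emeasure (quenched_law x \<omega>) (cylinder n y) * emeasure (quenched_law (y n) \<omega>) A"
proof -
  let ?P = "quenched_law x \<omega>" and ?c = "emeasure (quenched_law x \<omega>) (cylinder n y)"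
  \<comment> \<open>The law restricted to the past \<open>y\<close>, pushed forward by the
    shift.\<close>
  let ?M = "distr (density ?P (indicator (cylinder n y))) path_space (time_shift n)"
  note sets_P [measurable_cong] = sets_quenched_law[OF \<omega>, of x]
  have M: "emeasure ?M B = emeasure ?P (cylinder n y \<inter> time_shift n -` B)"
    if [measurable]: "B \<in> sets path_space" for B
  proof -
    have "emeasure ?M B = emeasure (density ?P (indicator (cylinder n y))) (time_shift n -` B)"
      by (subst emeasure_distr) (auto simp: space_eq_UNIV[OF sets_P])
    also have "\<dots> = emeasure ?P (time_shift n -` B \<inter> cylinder n y)"
      using sets_vimage_path_space[OF measurable_time_shift that, of n]
      by (subst emeasure_density) (auto simp: sets_P indicator_inter_arith[symmetric] Int_commute mult.commute)
    finally show ?thesis by (simp add: Int_commute)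
  qed
  have "?M = scale_measure ?c (quenched_law (y n) \<omega>)"
  proof (rule path_measure_eqI)
    show "sets (scale_measure ?c (quenched_law (y n) \<omega>)) = sets path_space"
      by (simp add: sets_quenched_law \<omega>)
    have "emeasure ?M UNIV \<le> emeasure ?P UNIV"
      by (subst M) (auto intro!: emeasure_mono simp: sets_P)
    then show "emeasure ?M UNIV \<noteq> \<infinity>"
      by (auto simp: emeasure_quenched_law_UNIV[OF \<omega>] top_unique)
    fix k h
    show "emeasure ?M (cylinder k h) = emeasure (scale_measure ?c (quenched_law (y n) \<omega>)) (cylinder k h)"
    proof (cases "h 0 = y n")
      case True
      \<comment> \<open>The concatenation of \<open>y\<close> and \<open>h\<close>, which share the
        site at time \<open>n\<close>.\<close>
      let ?g = "\<lambda>i. if i \<le> n then y i else h (i - n)"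
      have g: "?g (n + i) = h i" for i
        using True by (cases i) auto
      have "cylinder n y \<inter> time_shift n -` cylinder k h = cylinder (n + k) ?g"
      proof (intro equalityI subsetI)
        fix X assume "X \<in> cylinder n y \<inter> time_shift n -` cylinder k h"
        then have *: "\<And>i. i \<le> n \<Longrightarrow> X i = y i" "\<And>i. i \<le> k \<Longrightarrow> X (n + i) = h i"
          by (auto simp: cylinder_def time_shift_def)
        have "X i = ?g i" if "i \<le> n + k" for i
          using *(1)[of i] *(2)[of "i - n"] that by auto
        then show "X \<in> cylinder (n + k) ?g"
          by (simp add: cylinder_def)
      next
        fix X assume "X \<in> cylinder (n + k) ?g"
        then have *: "X i = ?g i" if "i \<le> n + k" for i
          using that by (simp add: cylinder_def)
        have "X i = y i" if "i \<le> n" for i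
          using *[of i] that by simp
        moreover have "X (n + i) = h i" if "i \<le> k" for i
          using *[of "n + i"] that g by simp
        ultimately show "X \<in> cylinder n y \<inter> time_shift n -` cylinder k h"
          by (simp add: cylinder_def time_shift_def)
      qed
      moreover have "(\<Prod>i<n. ennreal (trans_prob \<omega> (?g i) (?g (Suc i)))) =
          (\<Prod>i<n. ennreal (trans_prob \<omega> (y i) (y (Suc i))))"
        by (intro prod.cong) auto
      moreover have "(\<Prod>i<k. ennreal (trans_prob \<omega> (?g (n + i)) (?g (Suc (n + i))))) =
          (\<Prod>i<k. ennreal (trans_prob \<omega> (h i) (h (Suc i))))"
        using g[of "Suc _"] by (intro prod.cong) (auto simp only: g add_Suc_right)
      ultimately show ?thesis
        using True by (simp add: M emeasure_quenched_law_cylinder[OF \<omega>] prod_lessThan_add del: add_Suc_right)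
    next
      case False
      \<comment> \<open>Past and future disagree about the site at time \<open>n\<close>; the
        right-hand side vanishes too, as that walk starts in \<open>y n\<close>.\<close>
      then have "cylinder n y \<inter> time_shift n -` cylinder k h = {}"
        by (force simp: cylinder_def time_shift_def)
      then show ?thesis
        using False by (simp add: M emeasure_quenched_law_cylinder[OF \<omega>])
    qed
  qed simp
  then show ?thesis
    using M[OF A] A by (simp add: sets_quenched_law \<omega>)
qed

section \<open>Translation in space\<close>

definition translate :: "'a :: plus \<Rightarrow> (nat \<Rightarrow> 'a) \<Rightarrow> nat \<Rightarrow> 'a"
  where "translate x X = (\<lambda>i. X i + x)"

lemma translate_apply: "translate x X i = X i + x"
  by (simp add: translate_def)

lemma measurable_translate [measurable]: "translate x \<in> path_space \<rightarrow>\<^sub>M path_space"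
  unfolding translate_def by (rule measurable_path_spaceI) (rule measurable_compose[OF measurable_coordinate], simp)

text \<open>Moving the starting point to the origin moves the environment along. It is enough to
  compare cylinders, whose transition probabilities agree factor by factor.\<close>

lemma quenched_law_translate:
  fixes x :: "int ^ 'd"
  assumes \<omega>: "is_environment \<omega>" and A: "A \<in> sets path_space"
  shows "emeasure (quenched_law x \<omega>) A = emeasure (quenched_law 0 (\<lambda>z. \<omega> (z + x))) (translate x -` A)"
proof -
  let ?\<omega> = "\<lambda>z. \<omega> (z + x)"
  have \<omega>': "is_environment ?\<omega>"
    using \<omega> by (simp add: is_environment_def)
  note sets_P [measurable_cong] = sets_quenched_law[OF \<omega>', of 0]
  let ?M = "distr (quenched_law 0 ?\<omega>) path_space (translate x)"
  have M: "emeasure ?M B = emeasure (quenched_law 0 ?\<omega>) (translate x -` B)"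
    if [measurable]: "B \<in> sets path_space" for B
    by (subst emeasure_distr) (auto simp: space_eq_UNIV[OF sets_P])
  have "quenched_law x \<omega> = ?M"
  proof (rule path_measure_eqI)
    fix n and y :: "nat \<Rightarrow> int ^ 'd"
    have "translate x -` cylinder n y = cylinder n (translate (- x) y)"
      by (auto simp: translate_def cylinder_def eq_diff_eq)
    moreover have "trans_prob ?\<omega> (u - x) (v - x) = trans_prob \<omega> u v" for u v
      by (simp add: trans_prob_def)
    ultimately show "emeasure (quenched_law x \<omega>) (cylinder n y) = emeasure ?M (cylinder n y)"
      by (simp add: M emeasure_quenched_law_cylinder \<omega> \<omega>' translate_def)
  qed (use \<omega> in \<open>simp_all add: sets_quenched_law emeasure_quenched_law_UNIV\<close>)
  then show ?thesis
    by (simp add: M A)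
qed

section \<open>Dependence on the environment at visited sites\<close>

lemma emeasure_quenched_law_cylinder_cong:
  assumes \<omega>: "is_environment \<omega>" "is_environment \<omega>'" and eq: "\<And>i. i < n \<Longrightarrow> \<omega> (y i) = \<omega>' (y i)"
  shows "emeasure (quenched_law x \<omega>) (cylinder n y) = emeasure (quenched_law x \<omega>') (cylinder n y)"
  \<comment> \<open>The environment at \<open>y n\<close> does not enter through time
    \<open>n\<close>, because the walk has not yet left that site.\<close>
  by (auto simp: emeasure_quenched_law_cylinder \<omega> trans_prob_def eq intro!: prod.cong)

text \<open>A walk that stays in \<open>S\<close> reads the environment in \<open>S\<close> only.
  Thus the two laws agree once restricted to \<open>confined S\<close>, which is checked on
  cylinders.\<close>

lemma quenched_law_confined_cong:
  fixes x :: "int ^ 'd"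
  assumes \<omega>: "is_environment \<omega>" "is_environment \<omega>'" and eq: "\<And>z. z \<in> S \<Longrightarrow> \<omega> z = \<omega>' z"
    and A: "A \<in> sets path_space" "A \<subseteq> confined S"
  shows "emeasure (quenched_law x \<omega>) A = emeasure (quenched_law x \<omega>') A"
proof -
  let ?P = "quenched_law x"
  let ?M = "\<lambda>\<omega>. density (?P \<omega>) (indicator (confined S))"
  have M: "emeasure (?M \<omega>) B = emeasure (?P \<omega>) (B \<inter> confined S)"
    if "is_environment \<omega>" "B \<in> sets path_space" for B \<omega>
    using that by (subst emeasure_density)
      (auto simp: sets_quenched_law indicator_inter_arith[symmetric] mult.commute intro!: borel_measurable_indicator)
  have "?M \<omega> = ?M \<omega>'"
  proof (rule path_measure_eqI)
    have "emeasure (?M \<omega>) UNIV \<le> emeasure (?P \<omega>) UNIV"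
      by (subst M) (auto intro!: emeasure_mono simp: sets_quenched_law \<omega>)
    then show "emeasure (?M \<omega>) UNIV \<noteq> \<infinity>"
      by (auto simp: emeasure_quenched_law_UNIV \<omega> top_unique)
    fix n and y :: "nat \<Rightarrow> int ^ 'd"
    \<comment> \<open>Confinement constrains infinitely many times, so it is reached as a decreasing
      limit of adapted events, to which the formula for finite paths applies.\<close>
    define C where "C k = cylinder n y \<inter> {X. \<forall>i\<le>n + k. X i \<in> S}" for k
    have C: "adapted (n + k) (C k)" for k
      unfolding C_def by (intro adapted_Int adapted_mono[OF adapted_cylinder]) (auto simp: adapted_def)
    have "cylinder n y \<inter> confined S = (\<Inter>k. C k)"
      by (auto simp: C_def confined_def) (metis le_add2)
    moreover have "emeasure (?P \<omega>) (\<Inter>k. C k) = (INF k. emeasure (?P \<omega>) (C k))"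
      if "is_environment \<omega>" for \<omega>
    proof (rule INF_emeasure_decseq[symmetric])
      show "range C \<subseteq> sets (?P \<omega>)"
        using sets_adapted[OF C] by (auto simp: sets_quenched_law that)
      show "decseq C"
        by (auto simp: C_def decseq_def)
      interpret prob_space "?P \<omega>" by (rule prob_space_quenched_law[OF that])
      show "emeasure (?P \<omega>) (C k) \<noteq> \<infinity>" for k by simp
    qed
    moreover have "emeasure (?P \<omega>) (C k) = emeasure (?P \<omega>') (C k)" for k
    proof -
      have "emeasure (?P \<omega>) (cylinder (n + k) h) = emeasure (?P \<omega>') (cylinder (n + k) h)" if "h \<in> C k" for h
        using that by (intro emeasure_quenched_law_cylinder_cong \<omega> eq) (simp add: C_def)
      then show ?thesis
        by (simp add: emeasure_adapted[OF sets_quenched_law[OF \<omega>(1)] C]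
            emeasure_adapted[OF sets_quenched_law[OF \<omega>(2)] C] cong: nn_integral_cong_simp)
    qed
    ultimately show "emeasure (?M \<omega>) (cylinder n y) = emeasure (?M \<omega>') (cylinder n y)"
      by (simp add: M \<omega>)
  qed (simp_all add: sets_quenched_law \<omega>)
  then show ?thesis
    using M[OF \<omega>(1) A(1)] M[OF \<omega>(2) A(1)] A(2) by (simp add: Int_absorb2)
qed

text \<open>Coordinates of a product measure are independent, so functions of disjoint blocks of
  coordinates are independent and the integral of their product factorises.\<close>

lemma nn_integral_PiM_mult_disjoint:
  fixes f g :: "('i \<Rightarrow> 'a) \<Rightarrow> ennreal"
  assumes "prob_space M"
    and [measurable]: "f \<in> borel_measurable (PiM UNIV (\<lambda>_. M))" "g \<in> borel_measurable (PiM UNIV (\<lambda>_. M))"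
    and f: "\<And>\<omega> \<omega>'. \<omega> \<in> space (PiM UNIV (\<lambda>_. M)) \<Longrightarrow> \<omega>' \<in> space (PiM UNIV (\<lambda>_. M)) \<Longrightarrow>
      (\<And>i. i \<in> A \<Longrightarrow> \<omega> i = \<omega>' i) \<Longrightarrow> f \<omega> = f \<omega>'"
    and g: "\<And>\<omega> \<omega>'. \<omega> \<in> space (PiM UNIV (\<lambda>_. M)) \<Longrightarrow> \<omega>' \<in> space (PiM UNIV (\<lambda>_. M)) \<Longrightarrow>
      (\<And>i. i \<in> B \<Longrightarrow> \<omega> i = \<omega>' i) \<Longrightarrow> g \<omega> = g \<omega>'"
    and "A \<inter> B = {}"
  shows "(\<integral>\<^sup>+\<omega>. f \<omega> * g \<omega> \<partial>PiM UNIV (\<lambda>_. M)) =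
    (\<integral>\<^sup>+\<omega>. f \<omega> \<partial>PiM UNIV (\<lambda>_. M)) * (\<integral>\<^sup>+\<omega>. g \<omega> \<partial>PiM UNIV (\<lambda>_. M))"
proof -
  let ?P = "PiM UNIV (\<lambda>_::'i. M)"
  interpret prob_space ?P
    using \<open>prob_space M\<close> by (intro prob_space_PiM)
  obtain \<omega>0 where \<omega>0: "\<omega>0 \<in> space ?P"
    using not_empty by (metis ex_in_conv)
  then have \<omega>0_mem: "\<omega>0 i \<in> space M" for i
    by (auto simp: space_PiM)
  \<comment> \<open>Filling up with a fixed point \<omega>0 exhibits \<open>f\<close> and
    \<open>g\<close> as measurable functions of the restrictions to \<open>A\<close> and
    \<open>B\<close>.\<close>
  define ext where "ext C h = (\<lambda>i. if i \<in> C then h i else \<omega>0 i)" for C and h :: "'i \<Rightarrow> 'a"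
  have ext [measurable]: "ext C \<in> PiM C (\<lambda>_. M) \<rightarrow>\<^sub>M ?P" for C
  proof (rule measurable_PiM_single')
    show "(\<lambda>h. ext C h i) \<in> PiM C (\<lambda>_. M) \<rightarrow>\<^sub>M M" for i
      using \<omega>0_mem by (cases "i \<in> C") (auto simp: ext_def)
  qed (use \<omega>0_mem in \<open>auto simp: ext_def space_PiM PiE_iff\<close>)
  let ?r = "\<lambda>C \<omega>. restrict (\<lambda>i. \<omega> i) C"
  have ext_r: "ext C (?r C \<omega>) \<in> space ?P" "i \<in> C \<Longrightarrow> ext C (?r C \<omega>) i = \<omega> i" if "\<omega> \<in> space ?P" for C \<omega> i
    using that \<omega>0_mem by (auto simp: ext_def space_PiM PiE_iff)
  have "distr ?P M (\<lambda>\<omega>. \<omega> i) = M" for i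
    using \<open>prob_space M\<close> by (intro distr_PiM_component) auto
  moreover have "distr ?P ?P (\<lambda>\<omega>. restrict \<omega> UNIV) = ?P"
    by (simp add: restrict_def)
  ultimately have "indep_vars (\<lambda>_. M) (\<lambda>i \<omega>. \<omega> i) UNIV"
    by (subst indep_vars_iff_distr_eq_PiM) auto
  then have "indep_var (PiM A (\<lambda>_. M)) (?r A) (PiM B (\<lambda>_. M)) (?r B)"
    using \<open>A \<inter> B = {}\<close> by (rule indep_var_restrict) auto
  then have "indep_var borel ((\<lambda>h. f (ext A h)) \<circ> ?r A) borel ((\<lambda>h. g (ext B h)) \<circ> ?r B)"
    by (rule indep_var_compose) measurable
  \<comment> \<open>\<open>indep_var\<close> is defined through a family of target spaces chosen by
    a Boolean; here both are \<open>borel\<close>, so the family is constant.\<close>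
  then have "indep_vars (\<lambda>_. borel) (case_bool ((\<lambda>h. f (ext A h)) \<circ> ?r A) ((\<lambda>h. g (ext B h)) \<circ> ?r B)) UNIV"
    unfolding indep_var_def by (rule back_subst[where P = "\<lambda>N. indep_vars N _ _"]) (auto split: bool.split)
  from indep_vars_nn_integral[OF finite this]
  have "(\<integral>\<^sup>+\<omega>. f (ext A (?r A \<omega>)) * g (ext B (?r B \<omega>)) \<partial>?P) =
      (\<integral>\<^sup>+\<omega>. f (ext A (?r A \<omega>)) \<partial>?P) * (\<integral>\<^sup>+\<omega>. g (ext B (?r B \<omega>)) \<partial>?P)"
    by (simp add: UNIV_bool comp_def mult.commute)
  moreover have "f (ext A (?r A \<omega>)) = f \<omega>" "g (ext B (?r B \<omega>)) = g \<omega>" if "\<omega> \<in> space ?P" for \<omega>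
    using ext_r[OF that] that by (auto intro!: f g)
  ultimately show ?thesis
    by (simp cong: nn_integral_cong)
qed

section \<open>The annealed law of the walk alone\<close>

definition path_law :: "(int ^ 'd \<Rightarrow> real) measure \<Rightarrow> int ^ 'd \<Rightarrow> (nat \<Rightarrow> int ^ 'd) measure"
  where "path_law \<mu> x = distr (annealed_law \<mu> x) path_space snd"

lemma sets_path_law [simp, measurable_cong]: "sets (path_law \<mu> x) = sets path_space"
  by (simp add: path_law_def)

context
  fixes \<mu> :: "(int ^ 'd \<Rightarrow> real) measure"
  assumes \<mu>: "site_law \<mu>"
begin

lemma measurable_snd_annealed_law: "snd \<in> annealed_law \<mu> x \<rightarrow>\<^sub>M path_space"
  by (simp add: measurable_cong_sets[OF sets_annealed_law[OF \<mu>] refl])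

lemma prob_space_path_law: "prob_space (path_law \<mu> x)"
  unfolding path_law_def
  by (intro prob_space.prob_space_distr prob_space_annealed_law measurable_snd_annealed_law \<mu>)

lemma emeasure_path_law:
  assumes "A \<in> sets path_space"
  shows "emeasure (path_law \<mu> x) A = (\<integral>\<^sup>+\<omega>. emeasure (quenched_law x \<omega>) A \<partial>env_law \<mu>)"
proof -
  have "emeasure (path_law \<mu> x) A = emeasure (annealed_law \<mu> x) (snd -` A \<inter> space (annealed_law \<mu> x))"
    unfolding path_law_def using assms by (rule emeasure_distr[OF measurable_snd_annealed_law])
  also have "snd -` A \<inter> space (annealed_law \<mu> x) = space (env_law \<mu>) \<times> A"
    using sets_eq_imp_space_eq[OF sets_annealed_law[OF \<mu>, of x]] by (auto simp: space_pair_measure)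
  also have "emeasure (annealed_law \<mu> x) \<dots> = (\<integral>\<^sup>+\<omega>. emeasure (quenched_law x \<omega>) A \<partial>env_law \<mu>)"
    using assms by (subst emeasure_annealed_law[OF \<mu>]) (auto intro!: nn_integral_cong)
  finally show ?thesis .
qed

lemma measurable_emeasure_quenched_law:
  assumes "A \<in> sets path_space"
  shows "(\<lambda>\<omega>. emeasure (quenched_law x \<omega>) A) \<in> borel_measurable (env_law \<mu>)"
  using measurable_compose[OF measurable_quenched_law measurable_emeasure_subprob_algebra[OF assms]]
  by (simp add: measurable_cong_sets[OF sets_env_law[OF \<mu>] refl])

text \<open>An i.i.d. environment is stationary: translation merely permutes the factors of the
  product.\<close>

lemma distr_env_law_translate:
  "distr (env_law \<mu>) (env_law \<mu>) (\<lambda>\<omega> z. \<omega> (z + x)) = env_law \<mu>"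
  using distr_PiM_reindex[of UNIV "\<lambda>_. \<mu>" "\<lambda>z. z + x" UNIV] \<mu>
  by (simp add: env_law_def site_law_def inj_def restrict_def)

lemma measurable_env_translate: "(\<lambda>\<omega> z. \<omega> (z + x)) \<in> env_law \<mu> \<rightarrow>\<^sub>M env_law \<mu>"
  unfolding env_law_def by (rule measurable_PiM_single') (auto simp: space_PiM)

lemma path_law_translate:
  assumes A: "A \<in> sets path_space"
  shows "emeasure (path_law \<mu> x) A = emeasure (path_law \<mu> 0) (translate x -` A)"
proof -
  note tA = sets_vimage_path_space[OF measurable_translate A, of x]
  have "emeasure (path_law \<mu> x) A =
      (\<integral>\<^sup>+\<omega>. emeasure (quenched_law 0 (\<lambda>z. \<omega> (z + x))) (translate x -` A) \<partial>env_law \<mu>)"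
    by (simp add: emeasure_path_law A quenched_law_translate is_environment_env_law[OF \<mu>] cong: nn_integral_cong)
  also have "\<dots> = (\<integral>\<^sup>+\<omega>. emeasure (quenched_law 0 \<omega>) (translate x -` A)
      \<partial>distr (env_law \<mu>) (env_law \<mu>) (\<lambda>\<omega> z. \<omega> (z + x)))"
    using measurable_emeasure_quenched_law[OF tA]
    by (intro nn_integral_distr[symmetric] measurable_env_translate) simp
  also have "\<dots> = emeasure (path_law \<mu> 0) (translate x -` A)"
    by (simp add: distr_env_law_translate emeasure_path_law tA)
  finally show ?thesis .
qed

text \<open>Given the environment, past and future multiply by the Markov property. The past uses
  sites outside \<open>S\<close>, the future sites in \<open>S\<close>, so the two factors are
  independent and the average factorises. The site \<open>y n\<close> may lie in \<open>S\<close>,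
  as the first \<open>n\<close> steps do not leave it.\<close>

lemma path_law_regeneration:
  assumes A: "A \<in> sets path_space" "A \<subseteq> confined S" and y: "\<And>i. i < n \<Longrightarrow> y i \<notin> S"
  shows "emeasure (path_law \<mu> x) (cylinder n y \<inter> time_shift n -` A) =
    emeasure (path_law \<mu> x) (cylinder n y) * emeasure (path_law \<mu> (y n)) A"
proof -
  note env = is_environment_env_law[OF \<mu>]
  have "emeasure (path_law \<mu> x) (cylinder n y \<inter> time_shift n -` A) =
      (\<integral>\<^sup>+\<omega>. emeasure (quenched_law x \<omega>) (cylinder n y) * emeasure (quenched_law (y n) \<omega>) A \<partial>env_law \<mu>)"
    using sets_vimage_path_space[OF measurable_time_shift A(1), of n]
    by (simp add: emeasure_path_law quenched_markov A env cong: nn_integral_cong)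
  also have "\<dots> = (\<integral>\<^sup>+\<omega>. emeasure (quenched_law x \<omega>) (cylinder n y) \<partial>env_law \<mu>) *
      (\<integral>\<^sup>+\<omega>. emeasure (quenched_law (y n) \<omega>) A \<partial>env_law \<mu>)"
    unfolding env_law_def
  proof (rule nn_integral_PiM_mult_disjoint[where A = "- S" and B = S])
    show "prob_space \<mu>" using \<mu> by (simp add: site_law_def)
  qed (use y A in \<open>auto intro!: measurable_emeasure_quenched_law[unfolded env_law_def]
      emeasure_quenched_law_cylinder_cong quenched_law_confined_cong[of _ _ S] env[unfolded env_law_def]\<close>)
  finally show ?thesis
    using A by (simp add: emeasure_path_law)
qed

end

subsection \<open>Paths with an asymptotic direction\<close>

definition transient :: "(nat \<Rightarrow> 'a) \<Rightarrow> bool"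
  where "transient X \<longleftrightarrow> (\<forall>z. \<forall>\<^sub>F n in sequentially. X n \<noteq> z)"

text \<open>Transience makes the event invariant under translation. In dimension one, a path
  alternating between 1 and 2 has direction 1, but its translate by -2 has no direction.\<close>

definition directed :: "real ^ 'd \<Rightarrow> (nat \<Rightarrow> int ^ 'd) set"
  where "directed \<nu> = {X. transient X \<and> has_asymptotic_direction X \<nu>}"

lemma real_vec_add: "real_vec (x + y) = real_vec x + real_vec y"
  by (simp add: real_vec_def vec_eq_iff)

lemma real_vec_0 [simp]: "real_vec 0 = 0"
  by (simp add: real_vec_def vec_eq_iff)

lemma has_asymptotic_direction_sgn:
  "has_asymptotic_direction X \<nu> \<longleftrightarrow> (\<lambda>n. sgn (real_vec (X n))) \<longlonglongrightarrow> \<nu>"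
  by (simp add: has_asymptotic_direction_def sgn_div_norm)

lemma finite_norm_real_vec_less: "finite {z :: int ^ 'd. norm (real_vec z) < r}"
proof -
  define k where "k = \<lceil>r\<rceil>"
  have "vec_nth ` {z :: int ^ 'd. norm (real_vec z) < r} \<subseteq> UNIV \<rightarrow>\<^sub>E {-k..k}"
  proof (intro image_subsetI PiE_I)
    fix z :: "int ^ 'd" and i :: 'd
    assume "z \<in> {z. norm (real_vec z) < r}"
    then have "\<bar>real_vec z $ i\<bar> < r"
      using component_le_norm_cart[of "real_vec z" i] by simp
    then have "real_of_int \<bar>z $ i\<bar> < r"
      by (simp add: real_vec_def)
    then have "\<bar>z $ i\<bar> \<le> k"
      unfolding k_def by linarith
    then show "z $ i \<in> {-k..k}"
      by auto
  qed simp
  then have "finite (vec_nth ` {z :: int ^ 'd. norm (real_vec z) < r})"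
    by (rule finite_subset) (intro finite_PiE, auto)
  then show ?thesis
    by (rule finite_imageD) (simp add: inj_on_def vec_nth_inject)
qed

text \<open>A ball contains finitely many lattice sites, and each of them is eventually
  avoided.\<close>

lemma transient_norm_at_top:
  fixes X :: "nat \<Rightarrow> int ^ 'd"
  assumes "transient X"
  shows "filterlim (\<lambda>n. norm (real_vec (X n))) at_top sequentially"
  unfolding filterlim_at_top
proof
  fix r
  have "\<forall>\<^sub>F n in sequentially. \<forall>z\<in>{z :: int ^ 'd. norm (real_vec z) < r}. X n \<noteq> z"
    using assms by (intro eventually_ball_finite finite_norm_real_vec_less) (simp add: transient_def)
  then show "\<forall>\<^sub>F n in sequentially. r \<le> norm (real_vec (X n))"
    by eventually_elim (metis mem_Collect_eq not_less)
qed

text \<open>\<open>sgn\<close> ignores positive factors and is continuous away from 0; after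
  division by \<open>norm (u n)\<close> the shift \<open>v\<close> disappears in the limit.\<close>

lemma tendsto_sgn_add_const:
  fixes u :: "nat \<Rightarrow> 'a :: real_normed_vector"
  assumes u: "filterlim (\<lambda>n. norm (u n)) at_top sequentially"
    and lim: "(\<lambda>n. sgn (u n)) \<longlonglongrightarrow> \<nu>" and "norm \<nu> = 1"
  shows "(\<lambda>n. sgn (u n + v)) \<longlonglongrightarrow> \<nu>"
proof -
  have "\<nu> \<noteq> 0" and sgn_\<nu>: "sgn \<nu> = \<nu>"
    using \<open>norm \<nu> = 1\<close> by (auto simp: sgn_div_norm)
  have "(\<lambda>n. inverse (norm (u n))) \<longlonglongrightarrow> 0"
    using u by (rule tendsto_inverse_0_at_top)
  then have "(\<lambda>n. sgn (u n) + inverse (norm (u n)) *\<^sub>R v) \<longlonglongrightarrow> \<nu> + 0 *\<^sub>R v"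
    using lim by (intro tendsto_intros)
  then have "(\<lambda>n. sgn (sgn (u n) + inverse (norm (u n)) *\<^sub>R v)) \<longlonglongrightarrow> sgn \<nu>"
    using \<open>\<nu> \<noteq> 0\<close> by (intro tendsto_sgn) auto
  moreover have "\<forall>\<^sub>F n in sequentially. sgn (sgn (u n) + inverse (norm (u n)) *\<^sub>R v) = sgn (u n + v)"
    using filterlim_at_top_dense[THEN iffD1, OF u, rule_format, of 0]
  proof eventually_elim
    case (elim n)
    have "sgn (u n) + inverse (norm (u n)) *\<^sub>R v = inverse (norm (u n)) *\<^sub>R (u n + v)"
      by (simp add: sgn_div_norm scaleR_add_right)
    then show ?case
      using elim by (simp add: sgn_scaleR)
  qed
  ultimately show ?thesis
    unfolding sgn_\<nu> by (rule Lim_transform_eventually)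
qed

lemma directed_translate:
  assumes "norm \<nu> = 1" "X \<in> directed \<nu>"
  shows "translate x X \<in> directed \<nu>"
proof -
  have "translate x X n \<noteq> z \<longleftrightarrow> X n \<noteq> z - x" for n z
    by (auto simp: translate_def)
  moreover have "(\<lambda>n. sgn (real_vec (X n) + real_vec x)) \<longlonglongrightarrow> \<nu>"
    using assms by (intro tendsto_sgn_add_const transient_norm_at_top)
      (simp_all add: directed_def has_asymptotic_direction_sgn)
  ultimately show ?thesis
    using assms(2)
    by (simp add: directed_def transient_def has_asymptotic_direction_sgn translate_def real_vec_add)
qed

lemma directed_translate_iff:
  assumes "norm \<nu> = 1"
  shows "translate x X \<in> directed \<nu> \<longleftrightarrow> X \<in> directed \<nu>"
proof -
  have "translate (- x) (translate x X) = X"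
    by (simp add: translate_def)
  then show ?thesis
    using directed_translate[OF assms] by metis
qed

lemma directed_time_shift_iff: "time_shift n X \<in> directed \<nu> \<longleftrightarrow> X \<in> directed \<nu>"
proof -
  have "(\<forall>\<^sub>F i in sequentially. X (i + n) \<noteq> z) \<longleftrightarrow> (\<forall>\<^sub>F i in sequentially. X i \<noteq> z)" for z
    using eventually_sequentially_seg[of "\<lambda>i. X i \<noteq> z" n] .
  moreover have "(\<lambda>i. sgn (real_vec (X (i + n)))) \<longlonglongrightarrow> \<nu> \<longleftrightarrow> (\<lambda>i. sgn (real_vec (X i))) \<longlonglongrightarrow> \<nu>"
    by (rule iffI[OF LIMSEQ_offset LIMSEQ_ignore_initial_segment])
  ultimately show ?thesis
    by (simp add: directed_def transient_def has_asymptotic_direction_sgn time_shift_def add.commute[of n])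
qed

lemma directed_unique: "X \<in> directed \<nu> \<Longrightarrow> X \<in> directed \<nu>' \<Longrightarrow> \<nu> = \<nu>'"
  using LIMSEQ_unique by (auto simp: directed_def has_asymptotic_direction_def)

lemma sets_has_direction [measurable]:
  "{X. has_asymptotic_direction X (\<nu> :: real ^ 'd)} \<in> sets path_space"
proof -
  have "(\<lambda>X. sgn (real_vec (X n :: int ^ 'd))) \<in> borel_measurable path_space" for n
    by (rule measurable_compose[OF measurable_coordinate]) simp
  then have "Measurable.pred path_space (\<lambda>X. (\<lambda>n. dist (sgn (real_vec (X n))) \<nu>) \<longlonglongrightarrow> 0)"
    by (intro measurable_limit2 borel_measurable_dist) auto
  then show ?thesis
    unfolding has_asymptotic_direction_sgn tendsto_dist_iff[of _ \<nu>] by (rule sets_Collect_path_space)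
qed

lemma sets_transient [measurable]: "{X :: nat \<Rightarrow> int ^ 'd. transient X} \<in> sets path_space"
  unfolding transient_def eventually_sequentially by (rule sets_Collect_path_space) measurable

lemma sets_directed [measurable]: "directed \<nu> \<in> sets path_space"
proof -
  have "directed \<nu> = {X. transient X} \<inter> {X. has_asymptotic_direction X \<nu>}"
    by (auto simp: directed_def)
  then show ?thesis by simp
qed

text \<open>The inner product is the norm, which diverges, times a factor that tends to the positive
  number \<open>l \<bullet> \<nu>\<close>.\<close>

lemma directed_inner_at_top:
  fixes \<nu> l :: "real ^ 'd"
  assumes "X \<in> directed \<nu>" "0 < l \<bullet> \<nu>"
  shows "filterlim (\<lambda>n. l \<bullet> real_vec (X n)) at_top sequentially"
proof -
  have "(\<lambda>n. l \<bullet> sgn (real_vec (X n))) \<longlonglongrightarrow> l \<bullet> \<nu>"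
    using assms by (intro tendsto_intros) (simp add: directed_def has_asymptotic_direction_sgn)
  moreover have "filterlim (\<lambda>n. norm (real_vec (X n))) at_top sequentially"
    using assms by (intro transient_norm_at_top) (simp add: directed_def)
  ultimately have "filterlim (\<lambda>n. (l \<bullet> sgn (real_vec (X n))) * norm (real_vec (X n))) at_top sequentially"
    using assms(2) by (intro filterlim_tendsto_pos_mult_at_top)
  moreover have "(l \<bullet> sgn v) * norm v = l \<bullet> v" for v :: "real ^ 'd"
    by (cases "v = 0") (simp_all add: sgn_div_norm)
  ultimately show ?thesis by simp
qed

section \<open>Minima and records of diverging real sequences\<close>

lemma attains_minimum_if_at_top:
  fixes f :: "nat \<Rightarrow> real"
  assumes "filterlim f at_top sequentially"
  shows "\<exists>n. \<forall>m. f n \<le> f m"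
proof -
  obtain N where N: "\<And>n. n \<ge> N \<Longrightarrow> f 0 \<le> f n"
    using assms unfolding filterlim_at_top eventually_sequentially by blast
  obtain n where n: "n \<le> N" "\<And>m. m \<le> N \<Longrightarrow> f n \<le> f m"
    using ex_min_if_finite[of "f ` {..N}"] by (auto simp: not_less) 
  have "f n \<le> f m" for m
    using n(2)[of m] n(2)[of 0] N[of m] by (cases "m \<le> N") auto
  then show ?thesis by blast
qed

lemma strict_records_if_at_top:
  fixes f :: "nat \<Rightarrow> real"
  assumes "filterlim f at_top sequentially"
  shows "\<exists>m\<ge>n. \<forall>i<m. f i < f m"
proof -
  define B where "B = Max (f ` {..n})"
  have "\<exists>m. B < f m"
    using filterlim_at_top_dense[THEN iffD1, OF assms, rule_format, of B] eventually_happens[of _ sequentially]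
    by auto
  \<comment> \<open>The first time above the maximum \<open>B\<close> of the values up to
    \<open>n\<close>: it comes after \<open>n\<close>, and all earlier values are at most
    \<open>B\<close>.\<close>
  define m where "m = (LEAST m. B < f m)"
  have m: "B < f m"
    unfolding m_def by (rule LeastI_ex) fact
  have "f i \<le> B" if "i < m" for i
    using not_less_Least[of i "\<lambda>m. B < f m"] that by (simp add: m_def)
  moreover have "f i \<le> B" if "i \<le> n" for i
    using that by (simp add: B_def)
  then have "n \<le> m"
    using m by (metis linorder_not_le nat_le_linear)
  ultimately show ?thesis
    using m by fastforce
qed

subsection \<open>Transience of walks with an asymptotic direction\<close>

text \<open>Induction on the sum of the absolute coordinates: while some coordinate is nonzero, a
  unit step brings it closer to 0.\<close>

lemma unit_step_closed_0:
  fixes z :: "int ^ 'd"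
  assumes closed: "\<And>z e. z \<in> S \<Longrightarrow> e \<in> unit_steps \<Longrightarrow> z + e \<in> S" and "z \<in> S"
  shows "0 \<in> S"
  using \<open>z \<in> S\<close>
proof (induction "\<Sum>i\<in>UNIV. nat \<bar>z $ i\<bar>" arbitrary: z rule: less_induct)
  case less
  show ?case
  proof (cases "z = 0")
    case False
    then obtain i where i: "z $ i \<noteq> 0"
      by (auto simp: vec_eq_iff)
    define e where "e = axis i (- sgn (z $ i))"
    have "real_vec e = axis i (- real_of_int (sgn (z $ i)))"
      by (simp add: e_def real_vec_def axis_def vec_eq_iff)
    moreover have "axis i (- 1) = - axis i (1 :: real)"
      by (simp add: axis_def vec_eq_iff)
    ultimately have "e \<in> unit_steps"
      using i by (simp add: unit_steps_def sgn_if)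
    moreover have "(\<Sum>j\<in>UNIV. nat \<bar>(z + e) $ j\<bar>) < (\<Sum>j\<in>UNIV. nat \<bar>z $ j\<bar>)"
      using i by (intro sum_strict_mono_ex1) (auto simp: e_def axis_def sgn_if intro!: bexI[of _ i])
    ultimately show ?thesis
      using less closed by blast
  qed (use less in simp)
qed

text \<open>Every visit to \<open>z\<close> is followed by the step \<open>e\<close> with the same
  positive probability, so infinitely many visits to \<open>z\<close> cannot miss
  \<open>z + e\<close> from some time on.\<close>

lemma quenched_neighbour_recurrent:
  fixes z :: "int ^ 'd"
  assumes \<omega>: "is_environment \<omega>" and e: "e \<in> unit_steps" "0 < \<omega> z e"
  shows "AE X in quenched_law x \<omega>.
    (\<exists>\<^sub>F n in sequentially. X n = z) \<longrightarrow> (\<exists>\<^sub>F n in sequentially. X n = z + e)"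
proof -
  let ?P = "quenched_law x \<omega>"
  interpret prob_space ?P by (rule prob_space_quenched_law[OF \<omega>])
  note sets_P = sets_quenched_law[OF \<omega>, of x]
  define G where "G N = {X. (\<exists>\<^sub>F n in sequentially. X n = z) \<and> (\<forall>n\<ge>N. X n \<noteq> z + e)}" for N
  have G: "G N \<in> sets path_space" for N
    unfolding G_def frequently_def eventually_sequentially by (rule sets_Collect_path_space) measurable
  have "emeasure ?P (G N) = 0" for N
  proof (rule null_if_repeated_chances[where R = "\<lambda>n. {X. X n = z}" and H = "\<lambda>n. {X. X (Suc n) = z + e}" and N = N])
    show "adapted n {X. X n = z}" for n
      by (simp add: adapted_def)
    show "{X. X (Suc n) = z + e} \<in> sets path_space" for n
      by (rule sets_Collect_path_space) measurable
    show "\<exists>m\<ge>n. X \<in> {X. X m = z}" if "X \<in> G N" for X n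
      using that by (auto simp: G_def frequently_sequentially)
    show "G N \<inter> {X. X n = z} \<inter> {X. X (Suc n) = z + e} = {}" if "N \<le> n" for n
      using that by (auto simp: G_def)
    fix n and y :: "nat \<Rightarrow> int ^ 'd" assume "y \<in> {X. X n = z}"
    then have y: "y n = z" by simp
    \<comment> \<open>One more prescribed step gives a longer cylinder, whose probability has the
      extra factor for the step from \<open>z\<close>.\<close>
    have "cylinder n y \<inter> {X. X (Suc n) = z + e} = cylinder (Suc n) (y(Suc n := z + e))"
      by (auto simp: cylinder_def le_Suc_eq)
    then have "emeasure ?P (cylinder n y \<inter> {X. X (Suc n) = z + e}) =
        emeasure ?P (cylinder n y) * ennreal (trans_prob \<omega> z (z + e))"
      by (simp add: emeasure_quenched_law_cylinder[OF \<omega>] y cong: prod.cong_simp)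
    then show "ennreal (\<omega> z e) * emeasure ?P (cylinder n y) \<le>
        emeasure ?P (cylinder n y \<inter> {X. X (Suc n) = z + e})"
      using e by (simp add: trans_prob_def mult.commute)
  qed (use G e sets_P finite_measure_axioms in auto)
  then have "AE X in ?P. X \<notin> G N" for N
    using G by (intro AE_not_in) (simp add: null_sets_def sets_P)
  then have "AE X in ?P. \<forall>N. X \<notin> G N"
    by (simp add: AE_all_countable)
  then show ?thesis
    by eventually_elim (auto simp: G_def frequently_def eventually_sequentially)
qed

text \<open>Almost surely the set of sites visited infinitely often is closed under unit steps. If
  it were nonempty it would contain 0, which a limiting direction forbids.\<close>

lemma quenched_directed_if_direction:
  fixes \<nu> :: "real ^ 'd"
  assumes \<omega>: "is_environment \<omega>" and ell: "\<And>z e. e \<in> unit_steps \<Longrightarrow> 0 < \<omega> z e" and "norm \<nu> = 1"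
  shows "emeasure (quenched_law x \<omega>) {X. has_asymptotic_direction X \<nu>} =
    emeasure (quenched_law x \<omega>) (directed \<nu>)"
proof (rule emeasure_eq_AE)
  let ?io = "\<lambda>X z. \<exists>\<^sub>F n in sequentially. X n = (z :: int ^ 'd)"
  have "AE X in quenched_law x \<omega>. \<forall>z e. e \<in> unit_steps \<longrightarrow> ?io X z \<longrightarrow> ?io X (z + e)"
    unfolding AE_all_countable using quenched_neighbour_recurrent[OF \<omega> _ ell] by auto
  then show "AE X in quenched_law x \<omega>. X \<in> {X. has_asymptotic_direction X \<nu>} \<longleftrightarrow> X \<in> directed \<nu>"
  proof eventually_elim
    case (elim X)
    have "transient X" if lim: "has_asymptotic_direction X \<nu>"
    proof (rule ccontr)
      assume "\<not> transient X"
      then obtain z where "z \<in> {z. ?io X z}"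
        by (auto simp: transient_def frequently_def)
      then have "0 \<in> {z. ?io X z}"
        by (rule unit_step_closed_0[rotated]) (use elim in auto)
      \<comment> \<open>At the origin the direction has the default value 0, whereas it converges to
        a unit vector.\<close>
      moreover have "\<forall>\<^sub>F n in sequentially. sgn (real_vec (X n)) \<noteq> 0"
        using lim \<open>norm \<nu> = 1\<close> unfolding has_asymptotic_direction_sgn
        by (intro tendsto_imp_eventually_ne) auto
      then have "\<forall>\<^sub>F n in sequentially. X n \<noteq> 0"
        by eventually_elim auto
      ultimately show False
        by (simp add: frequently_def)
    qed
    then show ?case
      by (auto simp: directed_def)
  qed
qed (simp_all add: sets_quenched_law[OF \<omega>])

context
  fixes \<mu> :: "(int ^ 'd \<Rightarrow> real) measure"
  assumes \<mu>: "site_law \<mu>"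
begin

text \<open>Stationarity carries ellipticity from the site 0 to every site; there are only countably
  many exceptional null sets.\<close>

lemma AE_elliptic:
  assumes "strictly_elliptic \<mu>"
  shows "AE \<omega> in env_law \<mu>. \<forall>z. \<forall>e\<in>unit_steps. 0 < \<omega> z e"
proof -
  have "AE \<omega> in env_law \<mu>. 0 < \<omega> z e" if "e \<in> unit_steps" for z e
  proof -
    have "AE \<omega> in distr (env_law \<mu>) (env_law \<mu>) (\<lambda>\<omega> u. \<omega> (u + z)). 0 < \<omega> 0 e"
      unfolding distr_env_law_translate[OF \<mu>] using assms that by (simp add: strictly_elliptic_def)
    from AE_distrD[OF measurable_env_translate[OF \<mu>] this] show ?thesis
      by simp
  qed
  then show ?thesis
    by (simp add: AE_all_countable AE_ball_countable countable_finite finite_unit_steps)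
qed

text \<open>Passes from the event in the definition of asymptotic directions to
  \<open>directed\<close>: by ellipticity both have the same quenched probability in almost every
  environment.\<close>

lemma path_law_directed_pos:
  assumes "strictly_elliptic \<mu>" "\<nu> \<in> asymptotic_directions \<mu> x"
  shows "0 < emeasure (path_law \<mu> x) (directed \<nu>)"
proof -
  have \<nu>: "norm \<nu> = 1"
    and pos: "0 < \<P>(\<omega>X in annealed_law \<mu> x. has_asymptotic_direction (snd \<omega>X) \<nu>)"
    using assms(2) by (auto simp: asymptotic_directions_def)
  interpret prob_space "annealed_law \<mu> x" by (rule prob_space_annealed_law[OF \<mu>])
  have "0 < emeasure (annealed_law \<mu> x) {\<omega>X \<in> space (annealed_law \<mu> x). has_asymptotic_direction (snd \<omega>X) \<nu>}"
    using pos by (simp add: emeasure_eq_measure)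
  also have "\<dots> = emeasure (path_law \<mu> x) {X. has_asymptotic_direction X \<nu>}"
    unfolding path_law_def
    by (subst emeasure_distr[OF measurable_snd_annealed_law[OF \<mu>]])
      (auto intro!: arg_cong[where f = "emeasure _"])
  also have "\<dots> = emeasure (path_law \<mu> x) (directed \<nu>)"
    unfolding emeasure_path_law[OF \<mu> sets_has_direction] emeasure_path_law[OF \<mu> sets_directed]
  proof (rule nn_integral_cong_AE)
    show "AE \<omega> in env_law \<mu>. emeasure (quenched_law x \<omega>) {X. has_asymptotic_direction X \<nu>} =
        emeasure (quenched_law x \<omega>) (directed \<nu>)"
      using AE_elliptic[OF assms(1)] AE_space
      by eventually_elim (intro quenched_directed_if_direction is_environment_env_law[OF \<mu>] \<nu>, auto)
  qed
  finally show ?thesis .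
qed

end

subsection \<open>Regeneration at record times\<close>

definition half_space :: "real ^ 'd \<Rightarrow> int ^ 'd \<Rightarrow> (int ^ 'd) set"
  where "half_space l x = {z. l \<bullet> real_vec x \<le> l \<bullet> real_vec z}"

definition advancing :: "real ^ 'd \<Rightarrow> real ^ 'd \<Rightarrow> int ^ 'd \<Rightarrow> (nat \<Rightarrow> int ^ 'd) set"
  where "advancing \<nu> l x = directed \<nu> \<inter> confined (half_space l x)"

definition advancing_from :: "real ^ 'd \<Rightarrow> real ^ 'd \<Rightarrow> nat \<Rightarrow> (nat \<Rightarrow> int ^ 'd) set"
  where "advancing_from \<nu> l n = {X. time_shift n X \<in> advancing \<nu> l (X n)}"

lemma sets_advancing [measurable]: "advancing \<nu> l x \<in> sets path_space"
  unfolding advancing_def by measurable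

lemma vimage_translate_advancing:
  "norm \<nu> = 1 \<Longrightarrow> translate x -` advancing \<nu> l x = advancing \<nu> l 0"
  by (auto simp: advancing_def directed_translate_iff confined_def half_space_def translate_apply
      real_vec_add inner_add_right)

lemma sets_advancing_from [measurable]:
  fixes \<nu> l :: "real ^ 'd"
  shows "advancing_from \<nu> l n \<in> sets path_space"
proof -
  have "advancing_from \<nu> l n = time_shift n -` directed \<nu> \<inter>
      {X. \<forall>i. l \<bullet> real_vec (X n) \<le> l \<bullet> real_vec (X (n + i))}"
    by (auto simp: advancing_from_def advancing_def confined_def half_space_def time_shift_def)
  moreover have "{X. \<forall>i. l \<bullet> real_vec (X n) \<le> l \<bullet> real_vec (X (n + i) :: int ^ 'd)} \<in> sets path_space"
  proof (rule sets_Collect_path_space)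
    have [measurable]: "(\<lambda>X. l \<bullet> real_vec (X k :: int ^ 'd)) \<in> borel_measurable path_space" for k
      by (rule measurable_compose[OF measurable_coordinate]) simp
    show "Measurable.pred path_space (\<lambda>X. \<forall>i. l \<bullet> real_vec (X n) \<le> l \<bullet> real_vec (X (n + i) :: int ^ 'd))"
      by measurable
  qed
  ultimately show ?thesis
    using sets_vimage_path_space[OF measurable_time_shift sets_directed, of n \<nu>] by auto
qed

text \<open>On a cylinder the random site \<open>X n\<close> is known, which turns the event into
  the shift of a fixed one, as the Markov and regeneration lemmas require.\<close>

lemma cylinder_Int_advancing_from:
  "cylinder n y \<inter> advancing_from \<nu> l n = cylinder n y \<inter> time_shift n -` advancing \<nu> l (y n)"
  by (auto simp: cylinder_def advancing_from_def)

text \<open>The level \<open>l \<bullet> X n\<close> tends to infinity and so attains its minimum;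
  from that time on the path stays above its current level.\<close>

lemma directed_subset_advancing_from:
  assumes "0 < l \<bullet> \<nu>"
  shows "directed \<nu> \<subseteq> (\<Union>n. advancing_from \<nu> l n)"
proof
  fix X assume X: "X \<in> directed \<nu>"
  obtain n where "\<And>m. l \<bullet> real_vec (X n) \<le> l \<bullet> real_vec (X m)"
    using attains_minimum_if_at_top[OF directed_inner_at_top[OF X assms]] by blast
  then have "X \<in> advancing_from \<nu> l n"
    using X by (simp add: advancing_from_def advancing_def directed_time_shift_iff confined_def half_space_def
        time_shift_apply)
  then show "X \<in> (\<Union>n. advancing_from \<nu> l n)"
    by blast
qed

context
  fixes \<mu> :: "(int ^ 'd \<Rightarrow> real) measure"
  assumes \<mu>: "site_law \<mu>"
begin

lemma path_law_advancing:
  "norm \<nu> = 1 \<Longrightarrow> emeasure (path_law \<mu> x) (advancing \<nu> l x) = emeasure (path_law \<mu> 0) (advancing \<nu> l 0)"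
  using path_law_translate[OF \<mu> sets_advancing, of x \<nu> l x] by (simp add: vimage_translate_advancing)

text \<open>Otherwise advancing would be null from every starting site, hence null from every time
  on, and these countably many events cover \<open>directed \<nu>\<close>.\<close>

lemma path_law_advancing_pos:
  assumes \<nu>: "norm \<nu> = 1" "0 < l \<bullet> \<nu>" and pos: "0 < emeasure (path_law \<mu> x) (directed \<nu>)"
  shows "0 < emeasure (path_law \<mu> 0) (advancing \<nu> l 0)"
proof (rule ccontr)
  let ?Q = "path_law \<mu>"
  assume "\<not> ?thesis"
  then have null: "emeasure (?Q z) (advancing \<nu> l z) = 0" for z
    using path_law_advancing[OF \<nu>(1), of z l] by simp
  have "emeasure (?Q x) (cylinder n y \<inter> advancing_from \<nu> l n) = 0" for n y
  proof -
    have "emeasure (?Q x) (cylinder n y \<inter> time_shift n -` advancing \<nu> l (y n)) =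
        (\<integral>\<^sup>+\<omega>. emeasure (quenched_law x \<omega>) (cylinder n y) * emeasure (quenched_law (y n) \<omega>) (advancing \<nu> l (y n)) \<partial>env_law \<mu>)"
      using sets_vimage_path_space[OF measurable_time_shift sets_advancing, of n \<nu> l "y n"]
      by (simp add: emeasure_path_law[OF \<mu>] quenched_markov is_environment_env_law[OF \<mu>] cong: nn_integral_cong)
    \<comment> \<open>Past and future share the environment here, so nothing factorises; bounding
      the past by 1 is enough for a null event.\<close>
    also have "\<dots> \<le> (\<integral>\<^sup>+\<omega>. 1 * emeasure (quenched_law (y n) \<omega>) (advancing \<nu> l (y n)) \<partial>env_law \<mu>)"
      by (intro nn_integral_mono mult_right_mono prob_space.emeasure_le_1 prob_space_quenched_law
          is_environment_env_law[OF \<mu>]) auto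
    also have "\<dots> = 0"
      using null[of "y n"] by (simp add: emeasure_path_law[OF \<mu>])
    finally show ?thesis
      by (simp add: cylinder_Int_advancing_from)
  qed
  then have "emeasure (?Q x) (advancing_from \<nu> l n) = 0" for n
    using emeasure_adapted_Int[of "?Q x" n UNIV "advancing_from \<nu> l n"] by (simp add: adapted_def)
  then have "emeasure (?Q x) (\<Union>n. advancing_from \<nu> l n) = 0"
    by (intro emeasure_UN_eq_0) auto
  then have "emeasure (?Q x) (directed \<nu>) \<le> 0"
    using emeasure_mono[OF directed_subset_advancing_from[OF \<nu>(2)], of "?Q x"] by auto
  then show False
    using pos by simp
qed

text \<open>At a strict record the regeneration lemma gives direction \<nu>' a fresh chance whose
  probability does not depend on the past, and direction \<nu> produces records forever while
  excluding direction \<nu>'.\<close>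

lemma directed_null:
  fixes \<nu> \<nu>' l :: "real ^ 'd"
  assumes \<nu>': "norm \<nu>' = 1" "0 < emeasure (path_law \<mu> 0) (advancing \<nu>' l 0)"
    and \<nu>: "0 < l \<bullet> \<nu>" "\<nu> \<noteq> \<nu>'"
  shows "emeasure (path_law \<mu> x) (directed \<nu>) = 0"
proof -
  let ?Q = "path_law \<mu>"
  interpret prob_space "?Q x" by (rule prob_space_path_law[OF \<mu>])
  interpret Q0: prob_space "?Q 0" by (rule prob_space_path_law[OF \<mu>])
  \<comment> \<open>Strictness matters: the half space is closed, so after a tie the future could
    read the environment of an earlier site.\<close>
  define R where "R n = {X :: nat \<Rightarrow> int ^ 'd. \<forall>i<n. l \<bullet> real_vec (X i) < l \<bullet> real_vec (X n)}" for n
  show ?thesis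
  proof (rule null_if_repeated_chances[where R = R and H = "advancing_from \<nu>' l" and N = 0])
    show "0 < measure (?Q 0) (advancing \<nu>' l 0)"
      using \<nu>'(2) by (simp add: Q0.emeasure_eq_measure)
    show "adapted n (R n)" for n
      unfolding adapted_def
    proof (intro allI impI)
      fix X Y :: "nat \<Rightarrow> int ^ 'd" assume eq: "\<forall>i\<le>n. X i = Y i" and "X \<in> R n"
      have "X n = Y n" and "X i = Y i" if "i < n" for i
        using eq that by auto
      then show "Y \<in> R n"
        using \<open>X \<in> R n\<close> by (simp add: R_def)
    qed
    show "\<exists>m\<ge>n. X \<in> R m" if "X \<in> directed \<nu>" for X n
      using strict_records_if_at_top[OF directed_inner_at_top[OF that \<nu>(1)]] by (simp add: R_def)
    show "directed \<nu> \<inter> R n \<inter> advancing_from \<nu>' l n = {}" for n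
    proof (rule equals0I)
      fix X assume "X \<in> directed \<nu> \<inter> R n \<inter> advancing_from \<nu>' l n"
      then have "X \<in> directed \<nu>" "X \<in> directed \<nu>'"
        by (simp_all add: advancing_from_def advancing_def directed_time_shift_iff)
      then show False
        using directed_unique \<nu>(2) by metis
    qed
    fix n y assume y: "y \<in> R n"
    have "emeasure (?Q x) (cylinder n y \<inter> advancing_from \<nu>' l n) =
        emeasure (?Q x) (cylinder n y) * emeasure (?Q (y n)) (advancing \<nu>' l (y n))"
      unfolding cylinder_Int_advancing_from
      by (rule path_law_regeneration[OF \<mu>, where S = "half_space l (y n)"])
        (use y in \<open>auto simp: advancing_def half_space_def R_def not_le\<close>)
    then show "ennreal (measure (?Q 0) (advancing \<nu>' l 0)) * emeasure (?Q x) (cylinder n y)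
        \<le> emeasure (?Q x) (cylinder n y \<inter> advancing_from \<nu>' l n)"
      by (simp add: path_law_advancing[OF \<nu>'(1), of "y n"] Q0.emeasure_eq_measure mult.commute)
  qed (simp_all add: finite_measure_axioms)
qed

lemma asymptotic_directions_opposite:
  assumes "strictly_elliptic \<mu>" "\<nu> \<in> asymptotic_directions \<mu> x" "\<nu>' \<in> asymptotic_directions \<mu> x" "\<nu> \<noteq> \<nu>'"
  shows "\<nu>' = - \<nu>"
proof (rule ccontr)
  assume "\<nu>' \<noteq> - \<nu>"
  have norm: "norm \<nu> = 1" "norm \<nu>' = 1"
    using assms by (auto simp: asymptotic_directions_def)
  \<comment> \<open>Both inner products equal 1 + \<nu> \<bullet> \<nu>', half of
    \<open>l \<bullet> l\<close>, and are therefore positive.\<close>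
  define l where "l = \<nu> + \<nu>'"
  have "l \<noteq> 0"
    using \<open>\<nu>' \<noteq> - \<nu>\<close> by (auto simp: l_def add_eq_0_iff)
  then have "0 < l \<bullet> l"
    by simp
  moreover have "\<nu> \<bullet> \<nu> = 1" "\<nu>' \<bullet> \<nu>' = 1"
    using norm by (simp_all add: dot_square_norm)
  ultimately have l: "0 < l \<bullet> \<nu>" "0 < l \<bullet> \<nu>'"
    by (simp_all add: l_def inner_add_left inner_add_right inner_commute)
  \<comment> \<open>Direction \<nu>' supplies the chances, and direction \<nu> becomes the null
    event.\<close>
  have "0 < emeasure (path_law \<mu> 0) (advancing \<nu>' l 0)"
    by (rule path_law_advancing_pos[OF norm(2) l(2) path_law_directed_pos[OF \<mu> assms(1,3)]])
  then have "emeasure (path_law \<mu> x) (directed \<nu>) = 0"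
    by (rule directed_null[OF norm(2) _ l(1) \<open>\<nu> \<noteq> \<nu>'\<close>])
  then show False
    using path_law_directed_pos[OF \<mu> assms(1,2)] by simp
qed

end

theorem corollary1:
  fixes \<mu> :: "(int ^ 'd \<Rightarrow> real) measure"
  assumes "site_law \<mu>"
    and "strictly_elliptic \<mu>"
  shows "finite (asymptotic_directions \<mu> 0)
    \<and> card (asymptotic_directions \<mu> 0) \<le> 2
    \<and> (card (asymptotic_directions \<mu> 0) = 2 \<longrightarrow>
         (\<exists>\<nu>. asymptotic_directions \<mu> 0 = {\<nu>, - \<nu>}))"
proof (cases "asymptotic_directions \<mu> 0 = {}")
  case False
  then obtain \<nu> where \<nu>: "\<nu> \<in> asymptotic_directions \<mu> 0"
    by blast
  then have sub: "asymptotic_directions \<mu> 0 \<subseteq> {\<nu>, - \<nu>}"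
    using asymptotic_directions_opposite[OF assms \<nu>] by blast
  have two: "card {\<nu>, - \<nu>} \<le> 2"
    by (simp add: card_insert_le_m1)
  \<comment> \<open>A subset with two elements of a set with at most two elements is the whole
    set.\<close>
  have "asymptotic_directions \<mu> 0 = {\<nu>, - \<nu>}" if "card (asymptotic_directions \<mu> 0) = 2"
    using sub two that by (intro card_seteq) auto
  then show ?thesis
    using finite_subset[OF sub] card_mono[OF _ sub] two by auto
qed simp

end
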